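(* Let $1\le k\le d$. Given a Euclidean closest-vector instance $B\in\mathbb Z^{d\times k}$, $\mathbf t\in\mathbb Z^d$, and $\beta\in\mathbb Z_{\ge0}$, with $B$ of column rank $k$, one can construct in deterministic polynomial time an integer vector $\mathbf c\in\mathbb Z^{d+k}$ and integers $r^2\in\mathbb Z_{\ge0}$ and $\Gamma\in\mathbb Z$ such that $$\exists\,\mathbf z\in\mathbb Z^k:\ \lVert B\mathbf z-\mathbf t\rVert_2^2\le\beta\quad\Longleftrightarrow\quad\exists\,\mathbf W\in\mathbb Z^{d+k}:\ \lVert\mathbf W\rVert_2^2\le r^2,\ \mathbf c^\top\mathbf W\ge\Gamma.$$ All output data have polynomial bit length. In particular, a full-rank $n$-dimensional closest-vector instance (that is, $d=k=n$) maps to an instance of the right-hand problem in dimension $2n$.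
   Context: All data are encoded in binary; "polynomial" means polynomial in the total binary encoding length of $(B,\mathbf t,\beta)$. The problem on the right-hand side is the decision version of $\mathrm{BallIP}$: given $\mathbf c\in\mathbb Z^N$, $r^2\in\mathbb Z_{\ge0}$, $\Gamma\in\mathbb Z$, decide whether some $\mathbf W\in\mathbb Z^N$ satisfies $\lVert\mathbf W\rVert_2^2\le r^2$ and $\mathbf c^\top\mathbf W\ge\Gamma$. *)

theory Defs
  imports
    "HOL-Library.Log_Nat"
    "HOL-Computational_Algebra.Polynomial"
    "Jordan_Normal_Form.DL_Rank"
begin

text \<open>
  The model of deterministic computation is the random access machine with logarithmic cost,
  in structured (while-program) form. The memory maps integer addresses to integers, a nested
  \<open>Mem (Mem e)\<close> is indirect addressing, and input and output are one-way streams of integers.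
  Every operation is charged at least the bit lengths of the addresses and values it handles
  (multiplication: the product of the lengths of its operands), so that polynomial running time
  coincides with polynomial time on a Turing machine.
\<close>

text \<open>Sign bit plus binary digits of the absolute value.\<close>

definition bit_length :: "int \<Rightarrow> nat" where
  "bit_length x = Suc (floorlog 2 (nat \<bar>x\<bar>))"

definition encoding_length :: "int list \<Rightarrow> nat" where
  "encoding_length xs = (\<Sum>x\<leftarrow>xs. bit_length x)"

datatype expr =
    Const int
  | Mem expr
  | Add expr expr
  | Sub expr expr
  | Mul expr expr

type_synonym memory = "int \<Rightarrow> int"

fun expr_value :: "memory \<Rightarrow> expr \<Rightarrow> int" where
  "expr_value m (Const n) = n"
| "expr_value m (Mem e) = m (expr_value m e)"
| "expr_value m (Add a b) = expr_value m a + expr_value m b"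
| "expr_value m (Sub a b) = expr_value m a - expr_value m b"
| "expr_value m (Mul a b) = expr_value m a * expr_value m b"

fun expr_cost :: "memory \<Rightarrow> expr \<Rightarrow> nat" where
  "expr_cost m (Const n) = bit_length n"
| "expr_cost m (Mem e) =
     expr_cost m e + bit_length (expr_value m e) + bit_length (m (expr_value m e))"
| "expr_cost m (Add a b) =
     expr_cost m a + expr_cost m b + bit_length (expr_value m a) + bit_length (expr_value m b)"
| "expr_cost m (Sub a b) =
     expr_cost m a + expr_cost m b + bit_length (expr_value m a) + bit_length (expr_value m b)"
| "expr_cost m (Mul a b) =
     expr_cost m a + expr_cost m b + bit_length (expr_value m a) * bit_length (expr_value m b)"

text \<open>
  \<open>Store a e\<close> writes the value of \<open>e\<close> to address \<open>a\<close>, \<open>Read a\<close> moves the next input to address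
  \<open>a\<close>, and \<open>Emit e\<close> appends the value of \<open>e\<close> to the output. The tests of \<open>IfPos\<close> and
  \<open>WhilePos\<close> ask whether the value of the expression is positive.
\<close>

datatype program =
    Skip
  | Store expr expr
  | Read expr
  | Emit expr
  | Seq program program
  | IfPos expr program program
  | WhilePos expr program

text \<open>Memory, remaining input, and output produced so far.\<close>

type_synonym config = "memory \<times> int list \<times> int list"

text \<open>
  \<open>exec P s n s'\<close>: started in \<open>s\<close>, the program \<open>P\<close> halts in \<open>s'\<close> with total cost \<open>n\<close>. There is no
  rule for reading from an exhausted input: the machine is stuck and does not halt regularly.
\<close>

inductive exec :: "program \<Rightarrow> config \<Rightarrow> nat \<Rightarrow> config \<Rightarrow> bool" where
  exec_Skip: "exec Skip s 1 s"
| exec_Store: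
    "exec (Store a e) (m, xs, ys)
       (1 + expr_cost m a + expr_cost m e
          + bit_length (expr_value m a) + bit_length (expr_value m e))
       (m(expr_value m a := expr_value m e), xs, ys)"
| exec_Read:
    "exec (Read a) (m, x # xs, ys)
       (1 + expr_cost m a + bit_length (expr_value m a) + bit_length x)
       (m(expr_value m a := x), xs, ys)"
| exec_Emit:
    "exec (Emit e) (m, xs, ys)
       (1 + expr_cost m e + bit_length (expr_value m e))
       (m, xs, ys @ [expr_value m e])"
| exec_Seq:
    "exec P s n s' \<Longrightarrow> exec Q s' n' s'' \<Longrightarrow> exec (Seq P Q) s (1 + n + n') s''"
| exec_IfPos_True:
    "expr_value (fst s) e > 0 \<Longrightarrow> exec P s n s' \<Longrightarrow>
     exec (IfPos e P Q) s (1 + expr_cost (fst s) e + n) s'"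
| exec_IfPos_False:
    "expr_value (fst s) e \<le> 0 \<Longrightarrow> exec Q s n s' \<Longrightarrow>
     exec (IfPos e P Q) s (1 + expr_cost (fst s) e + n) s'"
| exec_WhilePos_False:
    "expr_value (fst s) e \<le> 0 \<Longrightarrow> exec (WhilePos e P) s (1 + expr_cost (fst s) e) s"
| exec_WhilePos_True:
    "expr_value (fst s) e > 0 \<Longrightarrow> exec P s n s' \<Longrightarrow> exec (WhilePos e P) s' n' s'' \<Longrightarrow>
     exec (WhilePos e P) s (1 + expr_cost (fst s) e + n + n') s''"

lemma exec_deterministic:
  assumes "exec P s n s1" and "exec P s n' s2"
  shows "n = n' \<and> s1 = s2"
  using assms
proof (induction arbitrary: n' s2 rule: exec.induct)
  case (exec_Seq P s n s' Q n1 s'')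
  from exec_Seq.prems show ?case
    by cases (use exec_Seq.IH in blast)
next
  case (exec_IfPos_True s e P n s' Q)
  from exec_IfPos_True.prems show ?case
    by cases (use exec_IfPos_True in fastforce)+
next
  case (exec_IfPos_False s e Q n s' P)
  from exec_IfPos_False.prems show ?case
    by cases (use exec_IfPos_False in fastforce)+
next
  case (exec_WhilePos_False s e P)
  from exec_WhilePos_False.prems show ?case
    by cases (use exec_WhilePos_False in auto)
next
  case (exec_WhilePos_True s e P n s' n1 s'')
  from exec_WhilePos_True.prems show ?case
  proof cases
    case exec_WhilePos_False
    then show ?thesis using exec_WhilePos_True.hyps by simp
  next
    case (exec_WhilePos_True k u k')
    then show ?thesis using \<open>\<And>n' s2. exec P s n' s2 \<Longrightarrow> _\<close>
        \<open>\<And>n' s2. exec (WhilePos e P) s' n' s2 \<Longrightarrow> _\<close> by blast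
  qed
qed (auto elim: exec.cases)

text \<open>
  \<open>f\<close> is computable on \<open>D\<close> in deterministic polynomial time, with respect to the encodings
  \<open>enc\<close> of the arguments and \<open>enc'\<close> of the results. All memory cells are initially \<open>0\<close>.
\<close>

definition poly_time_computable_on ::
    "'a set \<Rightarrow> ('a \<Rightarrow> int list) \<Rightarrow> ('b \<Rightarrow> int list) \<Rightarrow> ('a \<Rightarrow> 'b) \<Rightarrow> bool" where
  "poly_time_computable_on D enc enc' f \<longleftrightarrow>
     (\<exists>P (p :: nat poly). \<forall>x\<in>D. \<exists>n m xs.
        exec P (\<lambda>_. 0, enc x, []) n (m, xs, enc' (f x)) \<and>
        n \<le> poly p (encoding_length (enc x)))"

type_synonym cvp_instance = "int mat \<times> int vec \<times> int"

definition cvp_instances :: "cvp_instance set" where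
  "cvp_instances = {(B, t, \<beta>).
     1 \<le> dim_col B \<and> dim_col B \<le> dim_row B \<and> dim_vec t = dim_row B \<and> 0 \<le> \<beta> \<and>
     vec_space.rank (dim_row B) (map_mat real_of_int B) = dim_col B}"

definition sq_norm2 :: "int vec \<Rightarrow> int" where
  "sq_norm2 v = v \<bullet> v"

text \<open>The triples \<open>(c, r2, \<Gamma>)\<close>; \<open>r2\<close> is the squared radius, the dimension is that of \<open>c\<close>.\<close>

type_synonym ballip_instance = "int vec \<times> int \<times> int"

definition ballip_instances :: "nat \<Rightarrow> ballip_instance set" where
  "ballip_instances N = {(c, r2, \<Gamma>). c \<in> carrier_vec N \<and> 0 \<le> r2}"

text \<open>
  Matrices are listed row by row. The dimensions in front make both encodings injective; they add
  at most logarithmically to the encoding length, since every entry has length at least \<open>1\<close>.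
\<close>

fun encode_cvp :: "cvp_instance \<Rightarrow> int list" where
  "encode_cvp (B, t, \<beta>) =
     [int (dim_row B), int (dim_col B)] @ concat (mat_to_list B) @ list_of_vec t @ [\<beta>]"

fun encode_ballip :: "ballip_instance \<Rightarrow> int list" where
  "encode_ballip (c, r2, \<Gamma>) = int (dim_vec c) # list_of_vec c @ [r2, \<Gamma>]"

end

theory Submission
  imports Defs
begin

text \<open>
  For a large integer \<open>S\<close> put \<open>\<rho> = S\<^sup>2 (\<beta> + 1) - 1\<close>. By Cramer's rule every \<open>z\<close> with
  \<open>\<parallel>B z - t\<parallel>\<^sup>2 \<le> \<beta>\<close> satisfies \<open>\<parallel>z\<parallel>\<^sup>2 < S\<^sup>2\<close>, so such a \<open>z\<close> exists iff some \<open>u = (y, z)\<close> with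
  \<open>y = S (B z - t)\<close> has \<open>\<parallel>u\<parallel>\<^sup>2 \<le> \<rho>\<close>. For \<open>M\<close> large compared with \<open>S\<close>, the \<open>d\<close> equations
  \<open>y = S (B z - t)\<close> on this ball are equivalent to the single equation \<open>c \<bullet> u = \<tau>\<close> obtained by
  summing them with the weights \<open>1, M, M\<^sup>2, \<dots>\<close>. Finally the substitution \<open>W = K c + u\<close> with
  \<open>2 K > \<rho>\<close> turns the hyperplane section of the ball \<open>\<parallel>u\<parallel>\<^sup>2 \<le> \<rho>\<close> into the integer points of a
  flat cap of a large ball around the origin.

  With \<open>A = 1 + \<Sum> x\<^sup>2\<close> over all input numbers \<open>x\<close>, the choices \<open>S = A\<^bsup>6k\<^esup>\<close> and \<open>M = S\<^sup>6\<close> suffice.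
\<close>

section \<open>Cost of programs with bounded memory\<close>

lemma bit_length_le_Suc_iff: "bit_length x \<le> Suc n \<longleftrightarrow> \<bar>x\<bar> < 2 ^ n"
proof -
  have "bit_length x \<le> Suc n \<longleftrightarrow> nat \<bar>x\<bar> < 2 ^ n"
    by (simp add: bit_length_def floorlog_le_iff)
  also have "\<dots> \<longleftrightarrow> \<bar>x\<bar> < 2 ^ n"
    by (simp add: nat_less_iff)
  finally show ?thesis .
qed

lemma bit_length_pos: "1 \<le> bit_length x"
  by (simp add: bit_length_def)

lemma abs_less_bit_length: "\<bar>x\<bar> < 2 ^ (bit_length x - 1)"
  using bit_length_le_Suc_iff[of x "bit_length x - 1"] bit_length_pos[of x] by simp

lemma bit_length_mono: "\<bar>x\<bar> \<le> \<bar>y\<bar> \<Longrightarrow> bit_length x \<le> bit_length y"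
  by (simp add: bit_length_def floorlog_mono)

text \<open>Cruder than the maximum plus one, but additive like the bound for products, so that one
  width function covers all three operations. It comes from comparing the sum with the product of
  \<open>\<bar>x\<bar> + 1\<close> and \<open>\<bar>y\<bar> + 1\<close>.\<close>

lemma bit_length_add: "bit_length (x + y) \<le> bit_length x + bit_length y"
proof -
  let ?a = "bit_length x - 1" and ?b = "bit_length y - 1"
  have "\<bar>x + y\<bar> \<le> (\<bar>x\<bar> + 1) * (\<bar>y\<bar> + 1)"
    using mult_nonneg_nonneg[OF abs_ge_zero[of x] abs_ge_zero[of y]] abs_triangle_ineq[of x y]
    unfolding distrib_left distrib_right by linarith
  also have "\<dots> \<le> 2 ^ ?a * 2 ^ ?b"
    using abs_less_bit_length[of x] abs_less_bit_length[of y] by (intro mult_mono) auto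
  also have "\<dots> = 2 ^ (?a + ?b)" by (simp add: power_add)
  also have "\<dots> < 2 ^ (?a + ?b + 1)" by simp
  finally have "bit_length (x + y) \<le> Suc (?a + ?b + 1)"
    by (simp only: bit_length_le_Suc_iff)
  then show ?thesis using bit_length_pos[of x] bit_length_pos[of y] by linarith
qed

lemma bit_length_diff: "bit_length (x - y) \<le> bit_length x + bit_length y"
  using bit_length_add[of x "- y"] by (simp add: bit_length_def)

lemma bit_length_mult: "bit_length (x * y) \<le> bit_length x + bit_length y"
proof -
  let ?a = "bit_length x - 1" and ?b = "bit_length y - 1"
  have "\<bar>x * y\<bar> < 2 ^ ?a * 2 ^ ?b"
    unfolding abs_mult
    using abs_less_bit_length[of x] abs_less_bit_length[of y] by (intro mult_strict_mono) auto
  also have "\<dots> = 2 ^ (?a + ?b)" by (simp add: power_add)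
  finally have "bit_length (x * y) \<le> Suc (?a + ?b)"
    by (simp only: bit_length_le_Suc_iff)
  then show ?thesis using bit_length_pos[of x] bit_length_pos[of y] by linarith
qed

text \<open>
  If every cell has bit length at most \<open>L \<ge> 1\<close>, then the value of \<open>e\<close> has bit length at most
  \<open>expr_width e * L\<close>, and every step of \<open>P\<close> costs at most \<open>program_weight P * L\<^sup>2\<close>.
\<close>

fun expr_width :: "expr \<Rightarrow> nat" where
  "expr_width (Const n) = bit_length n"
| "expr_width (Mem e) = 1"
| "expr_width (Add a b) = expr_width a + expr_width b"
| "expr_width (Sub a b) = expr_width a + expr_width b"
| "expr_width (Mul a b) = expr_width a + expr_width b"

fun expr_weight :: "expr \<Rightarrow> nat" where
  "expr_weight (Const n) = bit_length n"
| "expr_weight (Mem e) = expr_weight e + expr_width e + 1"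
| "expr_weight (Add a b) = expr_weight a + expr_weight b + expr_width a + expr_width b"
| "expr_weight (Sub a b) = expr_weight a + expr_weight b + expr_width a + expr_width b"
| "expr_weight (Mul a b) = expr_weight a + expr_weight b + expr_width a * expr_width b"

fun program_weight :: "program \<Rightarrow> nat" where
  "program_weight Skip = 1"
| "program_weight (Store a e) = 1 + expr_weight a + expr_weight e + expr_width a + expr_width e"
| "program_weight (Read a) = 2 + expr_weight a + expr_width a"
| "program_weight (Emit e) = 1 + expr_weight e + expr_width e"
| "program_weight (Seq P Q) = 1 + program_weight P + program_weight Q"
| "program_weight (IfPos e P Q) = 1 + expr_weight e + program_weight P + program_weight Q"
| "program_weight (WhilePos e P) = 1 + expr_weight e + program_weight P"

lemma bit_length_expr_value:
  assumes "\<And>a. bit_length (m a) \<le> L" and "1 \<le> L"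
  shows "bit_length (expr_value m e) \<le> expr_width e * L"
proof (induction e)
  case (Const n)
  show ?case using assms(2) by (cases L) auto
next
  case (Mem e)
  show ?case using assms(1) by simp
next
  case (Add a b)
  then show ?case
    using bit_length_add[of "expr_value m a" "expr_value m b"] by (simp add: algebra_simps)
next
  case (Sub a b)
  then show ?case
    using bit_length_diff[of "expr_value m a" "expr_value m b"] by (simp add: algebra_simps)
next
  case (Mul a b)
  then show ?case
    using bit_length_mult[of "expr_value m a" "expr_value m b"] by (simp add: algebra_simps)
qed

text \<open>Only multiplication is charged a product of lengths, which is where the square comes
  from; the linear charges are lifted by \<open>L \<le> L\<^sup>2\<close>.\<close>

lemma expr_cost_le:
  assumes "\<And>a. bit_length (m a) \<le> L" and "1 \<le> L"
  shows "expr_cost m e \<le> expr_weight e * L\<^sup>2"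
proof -
  have L: "L \<le> L\<^sup>2" using assms(2) by (simp add: power2_eq_square)
  have width: "bit_length (expr_value m e) \<le> expr_width e * L\<^sup>2" for e
    using bit_length_expr_value[of m L e, OF assms] L
    by (meson le_trans mult_le_mono2)
  show ?thesis
  proof (induction e)
    case (Const n)
    show ?case using assms(2) by simp
  next
    case (Mem e)
    have "bit_length (m (expr_value m e)) \<le> L\<^sup>2" using assms(1) L le_trans by blast
    with Mem width[of e] show ?case by (simp add: algebra_simps)
  next
    case (Add a b)
    with width[of a] width[of b] show ?case by (simp add: algebra_simps)
  next
    case (Sub a b)
    with width[of a] width[of b] show ?case by (simp add: algebra_simps)
  next
    case (Mul a b)
    have "bit_length (expr_value m a) * bit_length (expr_value m b)
        \<le> (expr_width a * L) * (expr_width b * L)"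
      by (intro mult_le_mono bit_length_expr_value assms)
    with Mul show ?case by (simp add: algebra_simps power2_eq_square)
  qed
qed

section \<open>Step counts under a common bound on the memory contents\<close>

definition bounded_config :: "int \<Rightarrow> config \<Rightarrow> bool" where
  "bounded_config H s \<longleftrightarrow>
     (\<forall>a. \<bar>fst s a\<bar> \<le> H) \<and> (\<forall>x\<in>set (fst (snd s)). \<bar>x\<bar> \<le> H)"

text \<open>
  \<open>t\<close> counts the executed statements, and \<open>H\<close> bounds the contents of the memory throughout the
  run. Hence a cost bound only needs a step count and a bound on every stored value; the size of
  intermediate and emitted values is taken care of by \<open>program_weight\<close>.
\<close>

definition runs :: "int \<Rightarrow> program \<Rightarrow> config \<Rightarrow> nat \<Rightarrow> config \<Rightarrow> bool" where
  "runs H P s t s' \<longleftrightarrow> 1 \<le> t \<and> (bounded_config H s \<longrightarrow> bounded_config H s' \<and>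
     (\<exists>n. exec P s n s' \<and> n \<le> t * program_weight P * (bit_length H)\<^sup>2))"

lemma bounded_config_bit_length:
  assumes "bounded_config H (m, xs, ys)"
  shows "bit_length (m a) \<le> bit_length H" "x \<in> set xs \<Longrightarrow> bit_length x \<le> bit_length H"
  using assms unfolding bounded_config_def
  by (auto intro!: bit_length_mono intro: order_trans[OF _ abs_ge_self])

lemma bounded_config_cost:
  assumes "bounded_config H (m, xs, ys)"
  shows "bit_length (expr_value m e) \<le> expr_width e * bit_length H"
    "expr_cost m e \<le> expr_weight e * (bit_length H)\<^sup>2"
  using bit_length_expr_value[of m "bit_length H"] expr_cost_le[of m "bit_length H"]
    bounded_config_bit_length(1)[OF assms] bit_length_pos by blast+

lemma width_le_square: "n \<le> w * bit_length H \<Longrightarrow> n \<le> w * (bit_length H)\<^sup>2"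
  by (rule order_trans[of _ "w * bit_length H"])
    (use bit_length_pos[of H] in \<open>auto simp: power2_eq_square\<close>)

lemma one_le_square: "1 \<le> (bit_length H)\<^sup>2"
  by (simp add: bit_length_def)

lemma runs_Store:
  assumes "expr_value m a = l" "expr_value m e = v" "\<bar>v\<bar> \<le> H"
  shows "runs H (Store a e) (m, xs, ys) 1 (m(l := v), xs, ys)"
  unfolding runs_def
proof (intro conjI impI)
  assume b: "bounded_config H (m, xs, ys)"
  show "bounded_config H (m(l := v), xs, ys)"
    using b assms(3) by (auto simp: bounded_config_def)
  have "exec (Store a e) (m, xs, ys)
       (1 + expr_cost m a + expr_cost m e
          + bit_length (expr_value m a) + bit_length (expr_value m e)) (m(l := v), xs, ys)"
    using exec_Store[of a e m xs ys] assms by simp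
  moreover have "1 + expr_cost m a + expr_cost m e
          + bit_length (expr_value m a) + bit_length (expr_value m e)
      \<le> 1 * program_weight (Store a e) * (bit_length H)\<^sup>2"
    using bounded_config_cost[OF b, of a] bounded_config_cost[OF b, of e] one_le_square[of H]
      width_le_square[of "bit_length (expr_value m a)" "expr_width a" H]
      width_le_square[of "bit_length (expr_value m e)" "expr_width e" H]
    by (simp add: algebra_simps)
  ultimately show "\<exists>n. exec (Store a e) (m, xs, ys) n (m(l := v), xs, ys)
      \<and> n \<le> 1 * program_weight (Store a e) * (bit_length H)\<^sup>2" by blast
qed simp

lemma runs_Read:
  assumes "expr_value m a = l"
  shows "runs H (Read a) (m, x # xs, ys) 1 (m(l := x), xs, ys)"
  unfolding runs_def
proof (intro conjI impI)
  assume b: "bounded_config H (m, x # xs, ys)"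
  show "bounded_config H (m(l := x), xs, ys)"
    using b by (auto simp: bounded_config_def)
  have "exec (Read a) (m, x # xs, ys)
       (1 + expr_cost m a + bit_length (expr_value m a) + bit_length x) (m(l := x), xs, ys)"
    using exec_Read[of a m x xs ys] assms by simp
  moreover have "1 + expr_cost m a + bit_length (expr_value m a) + bit_length x
      \<le> 1 * program_weight (Read a) * (bit_length H)\<^sup>2"
    using bounded_config_cost[OF b, of a] one_le_square[of H] bounded_config_bit_length(2)[OF b, of x]
      width_le_square[of "bit_length (expr_value m a)" "expr_width a" H]
      width_le_square[of "bit_length x" 1 H]
    by (simp add: algebra_simps)
  ultimately show "\<exists>n. exec (Read a) (m, x # xs, ys) n (m(l := x), xs, ys)
      \<and> n \<le> 1 * program_weight (Read a) * (bit_length H)\<^sup>2" by blast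
qed simp

lemma runs_Emit:
  assumes "expr_value m e = v"
  shows "runs H (Emit e) (m, xs, ys) 1 (m, xs, ys @ [v])"
  unfolding runs_def
proof (intro conjI impI)
  assume b: "bounded_config H (m, xs, ys)"
  show "bounded_config H (m, xs, ys @ [v])"
    using b by (auto simp: bounded_config_def)
  have "exec (Emit e) (m, xs, ys)
       (1 + expr_cost m e + bit_length (expr_value m e)) (m, xs, ys @ [v])"
    using exec_Emit[of e m xs ys] assms by simp
  moreover have "1 + expr_cost m e + bit_length (expr_value m e)
      \<le> 1 * program_weight (Emit e) * (bit_length H)\<^sup>2"
    using bounded_config_cost[OF b, of e] one_le_square[of H]
      width_le_square[of "bit_length (expr_value m e)" "expr_width e" H]
    by (simp add: algebra_simps)
  ultimately show "\<exists>n. exec (Emit e) (m, xs, ys) n (m, xs, ys @ [v])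
      \<and> n \<le> 1 * program_weight (Emit e) * (bit_length H)\<^sup>2" by blast
qed simp

lemma runs_Seq:
  assumes P: "runs H P s t s'" and Q: "runs H Q s' t' s''"
  shows "runs H (Seq P Q) s (t + t') s''"
  unfolding runs_def
proof (intro conjI impI)
  let ?L = "(bit_length H)\<^sup>2"
  show "1 \<le> t + t'" using P by (simp add: runs_def)
  assume "bounded_config H s"
  then obtain n n' where n: "exec P s n s'" "n \<le> t * program_weight P * ?L"
    and n': "exec Q s' n' s''" "n' \<le> t' * program_weight Q * ?L" and b: "bounded_config H s''"
    using P Q by (auto simp: runs_def)
  show "bounded_config H s''" by (fact b)
  \<comment> \<open>The unit that \<open>exec_Seq\<close> charges on its own is paid out of the
    first run; this uses the condition \<open>1 \<le> t\<close> in \<open>runs\<close>.\<close>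
  have "1 \<le> t * ?L"
    using P one_le_square[of H] by (metis mult_le_mono nat_mult_1 runs_def)
  then have "1 + n + n' \<le> t * (1 + program_weight P) * ?L + t' * program_weight Q * ?L"
    using n(2) n'(2) unfolding distrib_left distrib_right by linarith
  also have "\<dots> \<le> (t + t') * program_weight (Seq P Q) * ?L"
    by (simp add: algebra_simps)
  finally show "\<exists>n. exec (Seq P Q) s n s'' \<and> n \<le> (t + t') * program_weight (Seq P Q) * ?L"
    using exec_Seq[OF n(1) n'(1)] by blast
qed

text \<open>\<open>s j\<close> is the configuration at the \<open>j\<close>-th test, counted from 0.
  A round counts \<open>t\<close> steps for the body and one for its test; the last summand is the
  failing test.\<close>

lemma runs_While:
  assumes "\<And>j. j < r \<Longrightarrow> 0 < expr_value (fst (s j)) e"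
    and "expr_value (fst (s r)) e \<le> 0"
    and "\<And>j. j < r \<Longrightarrow> runs H P (s j) t (s (Suc j))"
  shows "runs H (WhilePos e P) (s 0) (r * (t + 1) + 1) (s r)"
  using assms
proof (induction r arbitrary: s)
  case 0
  show ?case unfolding runs_def
  proof (intro conjI impI)
    assume b: "bounded_config H (s 0)"
    then show "bounded_config H (s 0)" .
    have "exec (WhilePos e P) (s 0) (1 + expr_cost (fst (s 0)) e) (s 0)"
      using exec_WhilePos_False 0 by blast
    moreover have "bounded_config H (fst (s 0), snd (s 0))" using b by simp
    then have "expr_cost (fst (s 0)) e \<le> expr_weight e * (bit_length H)\<^sup>2"
      by (metis bounded_config_cost(2) prod.collapse)
    then have "1 + expr_cost (fst (s 0)) e \<le>
        (0 * (t + 1) + 1) * program_weight (WhilePos e P) * (bit_length H)\<^sup>2"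
      using one_le_square[of H] by (simp add: algebra_simps)
    ultimately show "\<exists>n. exec (WhilePos e P) (s 0) n (s 0) \<and>
        n \<le> (0 * (t + 1) + 1) * program_weight (WhilePos e P) * (bit_length H)\<^sup>2" by blast
  qed simp
next
  case (Suc r)
  let ?L = "(bit_length H)\<^sup>2" and ?w = "program_weight (WhilePos e P)"
  have IH: "runs H (WhilePos e P) (s 1) (r * (t + 1) + 1) (s (Suc r))"
    using Suc.IH[of "\<lambda>j. s (Suc j)"] Suc.prems by (simp add: Suc_less_eq)
  have P: "runs H P (s 0) t (s 1)" using Suc.prems(3)[of 0] by simp
  show ?case unfolding runs_def
  proof (intro conjI impI)
    assume b: "bounded_config H (s 0)"
    then obtain n n' where n: "exec P (s 0) n (s 1)" "n \<le> t * program_weight P * ?L"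
      and n': "exec (WhilePos e P) (s 1) n' (s (Suc r))" "n' \<le> (r * (t + 1) + 1) * ?w * ?L"
      and b': "bounded_config H (s (Suc r))"
      using P IH unfolding runs_def by metis
    show "bounded_config H (s (Suc r))" by (fact b')
    have "bounded_config H (fst (s 0), snd (s 0))" using b by simp
    then have c: "expr_cost (fst (s 0)) e \<le> expr_weight e * ?L"
      by (metis bounded_config_cost(2) prod.collapse)
    have "n \<le> t * ?w * ?L"
      using n(2) by (rule order_trans) (simp add: algebra_simps)
    moreover have "1 + expr_cost (fst (s 0)) e \<le> 1 * ?w * ?L"
      using c one_le_square[of H] by (simp add: algebra_simps)
    ultimately have "1 + expr_cost (fst (s 0)) e + n + n' \<le>
        1 * ?w * ?L + t * ?w * ?L + (r * (t + 1) + 1) * ?w * ?L"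
      using n'(2) by linarith
    also have "\<dots> = (Suc r * (t + 1) + 1) * ?w * ?L"
      by (simp add: algebra_simps del: program_weight.simps)
    finally show "\<exists>n. exec (WhilePos e P) (s 0) n (s (Suc r)) \<and>
        n \<le> (Suc r * (t + 1) + 1) * ?w * ?L"
      using exec_WhilePos_True[OF Suc.prems(1)[of 0] n(1) n'(1)] by auto
  qed simp
qed

section \<open>Encoding length of input and output\<close>

lemma encoding_length_append:
  "encoding_length (xs @ ys) = encoding_length xs + encoding_length ys"
  by (simp add: encoding_length_def)

text \<open>Emitting a number costs at least its bit length, so a time bound is also a bound on the
  output length.\<close>

lemma exec_output_length:
  assumes "exec P s n s'"
  shows "encoding_length (snd (snd s')) \<le> encoding_length (snd (snd s)) + n"
  using assms by induction (auto simp: encoding_length_append encoding_length_def)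

lemma length_le_encoding_length: "length xs \<le> encoding_length xs"
proof (induction xs)
  case (Cons x xs)
  then show ?case using bit_length_pos[of x] by (simp add: encoding_length_def)
qed (simp add: encoding_length_def)

text \<open>Ties the magnitude of the data to the input length. A single entry obeys
  \<open>1 + x\<^sup>2 \<le> (\<bar>x\<bar> + 1)\<^sup>2\<close>, which is at most a power of 4, and
  the product of the numbers \<open>1 + x\<^sup>2\<close> dominates 1 plus the sum of the
  squares.\<close>

lemma sum_squares_le_encoding_length:
  "1 + (\<Sum>x\<leftarrow>xs. x\<^sup>2) \<le> (4 :: int) ^ encoding_length xs"
proof (induction xs)
  case (Cons x xs)
  have "1 + x\<^sup>2 \<le> (2 ^ bit_length x)\<^sup>2"
  proof -
    have "\<bar>x\<bar> < 2 ^ bit_length x"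
      using abs_less_bit_length[of x]
      by (rule less_le_trans) (intro power_increasing, auto)
    then have "\<bar>x\<bar> + 1 \<le> 2 ^ bit_length x" by simp
    then have "(\<bar>x\<bar> + 1)\<^sup>2 \<le> (2 ^ bit_length x)\<^sup>2" by (intro power_mono) auto
    moreover have "(\<bar>x\<bar> + 1)\<^sup>2 = x\<^sup>2 + 2 * \<bar>x\<bar> + 1" by (simp add: power2_eq_square algebra_simps)
    ultimately show ?thesis by linarith
  qed
  also have "\<dots> = 4 ^ bit_length x"
    by (metis power_mult mult.commute power2_eq_square num_double numeral_times_numeral)
  finally have x: "1 + x\<^sup>2 \<le> 4 ^ bit_length x" .
  have "0 \<le> (\<Sum>x\<leftarrow>xs. x\<^sup>2)" by (intro sum_list_nonneg) auto
  then have "1 + (\<Sum>x\<leftarrow>x # xs. x\<^sup>2) \<le> (1 + x\<^sup>2) * (1 + (\<Sum>x\<leftarrow>xs. x\<^sup>2))"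
    by (simp add: algebra_simps)
  also have "\<dots> \<le> 4 ^ bit_length x * 4 ^ encoding_length xs"
    using x Cons \<open>0 \<le> (\<Sum>x\<leftarrow>xs. x\<^sup>2)\<close> by (intro mult_mono) auto
  finally show ?case by (simp add: encoding_length_def power_add)
qed (simp add: encoding_length_def)

section \<open>Correctness of the reduction\<close>

lemma (in vec_space) full_rank_distinct_cols:
  assumes "A \<in> carrier_mat n nc" and "rank A = nc"
  shows "distinct (cols A)"
proof -
  obtain S where S: "maximal S (\<lambda>T. T \<subseteq> set (cols A) \<and> lin_indpt T)"
    using maximal_exists[of "(\<lambda>T. T \<subseteq> set (cols A) \<and> lin_indpt T)" "card (set (cols A))" "{}"]
    by (meson List.finite_set card_mono empty_iff empty_subsetI finite_lin_indpt2 rev_finite_subset)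
  then have "card S \<le> card (set (cols A))" by (simp add: card_mono maximal_def)
  moreover have "card S = nc" using rank_card_indpt[OF assms(1) S] assms(2) by simp
  moreover have "length (cols A) = nc" using assms(1) by simp
  \<comment> \<open>A maximal independent subset of the column set already has \<open>nc\<close>
    elements, so none of the \<open>nc\<close> columns repeats. Independence refers to the set of
    columns, which would hide a repetition.\<close>
  ultimately show ?thesis
    by (metis card_distinct card_length le_antisym)
qed

lemma sq_norm2_eq_sum: "sq_norm2 v = (\<Sum>i<dim_vec v. (v $ i)\<^sup>2)"
  by (simp add: sq_norm2_def scalar_prod_def power2_eq_square atLeast0LessThan)

lemma sq_norm2_nonneg: "0 \<le> sq_norm2 v"
  by (simp add: sq_norm2_eq_sum sum_nonneg)

lemma square_le_sq_norm2:
  assumes "i < dim_vec v"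
  shows "(v $ i)\<^sup>2 \<le> sq_norm2 v"
  unfolding sq_norm2_eq_sum using assms by (intro member_le_sum) auto

lemma abs_le_square_int: "\<bar>x\<bar> \<le> x\<^sup>2" for x :: int
proof (cases "x = 0")
  case False
  then have "\<bar>x\<bar> * 1 \<le> \<bar>x\<bar> * \<bar>x\<bar>" by (intro mult_left_mono) auto
  then show ?thesis by (simp add: power2_eq_square)
qed simp

lemma abs_le_sq_norm2:
  assumes "i < dim_vec v"
  shows "\<bar>v $ i\<bar> \<le> sq_norm2 v"
  using square_le_sq_norm2[OF assms] abs_le_square_int order_trans by blast

text \<open>A kernel vector \<open>v\<close> of the Gram matrix satisfies \<open>\<parallel>B
  v\<parallel>\<^sup>2 = v \<bullet> B\<^sup>T B v = 0\<close>; hence \<open>B v = 0\<close>, and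
  read over the reals this contradicts the independence of the columns.\<close>

lemma det_Gram_nonzero:
  fixes B :: "int mat"
  assumes B: "B \<in> carrier_mat d k"
    and rank: "vec_space.rank d (map_mat real_of_int B) = k"
  shows "det (B\<^sup>T * B) \<noteq> 0"
proof
  let ?R = "map_mat real_of_int B"
  assume "det (B\<^sup>T * B) = 0"
  moreover have G: "B\<^sup>T * B \<in> carrier_mat k k" using B by simp
  ultimately obtain v where v: "v \<in> carrier_vec k" "v \<noteq> 0\<^sub>v k" "(B\<^sup>T * B) *\<^sub>v v = 0\<^sub>v k"
    using det_0_iff_vec_prod_zero[OF G] by blast
  have "sq_norm2 (B *\<^sub>v v) = (B\<^sup>T *\<^sub>v (B *\<^sub>v v)) \<bullet> v"
    using B v(1) unfolding sq_norm2_def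
    by (metis mult_mat_vec_carrier transpose_carrier_mat transpose_vec_mult_scalar transpose_transpose)
  also have "B\<^sup>T *\<^sub>v (B *\<^sub>v v) = 0\<^sub>v k"
    using B v by (metis assoc_mult_mat_vec transpose_carrier_mat)
  also have "0\<^sub>v k \<bullet> v = 0" using v(1) by simp
  finally have "(B *\<^sub>v v) $ i = 0" if "i < d" for i
    using square_le_sq_norm2[of i "B *\<^sub>v v"] that B by simp
  then have Bv: "B *\<^sub>v v = 0\<^sub>v d" using B by (intro eq_vecI) auto
  have R: "?R \<in> carrier_mat d k" using B by simp
  have "?R *\<^sub>v map_vec real_of_int v = map_vec real_of_int (B *\<^sub>v v)"
    by (rule of_int_hom.mult_mat_vec_hom[OF B v(1), symmetric])
  also have "\<dots> = 0\<^sub>v d" unfolding Bv by (intro eq_vecI) auto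
  finally have ker: "?R *\<^sub>v map_vec real_of_int v = 0\<^sub>v d" .
  have "map_vec real_of_int v \<noteq> 0\<^sub>v k"
  proof
    assume eq: "map_vec real_of_int v = 0\<^sub>v k"
    have "v $ i = 0" if "i < k" for i
      using arg_cong[OF eq, of "\<lambda>w. w $ i"] that v(1) by simp
    then show False using v(1,2) by (auto intro!: eq_vecI)
  qed
  moreover have "distinct (cols ?R)" by (rule vec_space.full_rank_distinct_cols[OF R rank])
  ultimately show False
    using vec_space.lin_depI[OF R, of "map_vec real_of_int v"] v(1) ker
      vec_space.full_rank_lin_indpt[OF R rank] by simp
qed

text \<open>Leibniz expansion: \<open>n!\<close> signed products of \<open>n\<close> entries
  each.\<close>

lemma abs_det_le:
  fixes G :: "int mat"
  assumes G: "G \<in> carrier_mat n n" and entry: "\<And>i j. i < n \<Longrightarrow> j < n \<Longrightarrow> \<bar>G $$ (i, j)\<bar> \<le> C"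
  shows "\<bar>det G\<bar> \<le> fact n * C ^ n"
proof -
  let ?P = "{p. p permutes {0..<n}}"
  have "\<bar>det G\<bar> \<le> (\<Sum>p\<in>?P. \<bar>signof p * (\<Prod>i = 0..<n. G $$ (i, p i))\<bar>)"
    unfolding det_def'[OF G] by (rule sum_abs)
  also have "\<dots> \<le> (\<Sum>p\<in>?P. C ^ n)"
  proof (rule sum_mono)
    fix p assume p: "p \<in> ?P"
    have "\<bar>signof p * (\<Prod>i = 0..<n. G $$ (i, p i))\<bar> = (\<Prod>i = 0..<n. \<bar>G $$ (i, p i)\<bar>)"
      by (simp add: abs_mult abs_prod sign_def)
    also have "\<dots> \<le> (\<Prod>i = 0..<n. C)"
      using p by (intro prod_mono) (auto intro!: entry dest: permutes_in_image[of _ _ i for i] simp: permutes_in_image)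
    finally show "\<bar>signof p * (\<Prod>i = 0..<n. G $$ (i, p i))\<bar> \<le> C ^ n" by simp
  qed
  also have "\<dots> = fact n * C ^ n"
    by (simp add: card_permutations)
  finally show ?thesis .
qed

lemma abs_sum_le_card:
  fixes f :: "nat \<Rightarrow> int"
  assumes "\<And>i. i < n \<Longrightarrow> \<bar>f i\<bar> \<le> C"
  shows "\<bar>\<Sum>i<n. f i\<bar> \<le> int n * C"
proof -
  have "\<bar>\<Sum>i<n. f i\<bar> \<le> (\<Sum>i<n. \<bar>f i\<bar>)" by (rule sum_abs)
  also have "\<dots> \<le> (\<Sum>i<n. C)" using assms by (intro sum_mono) auto
  finally show ?thesis by simp
qed

lemma mult_mat_vec_index_sum:
  assumes "B \<in> carrier_mat d k" "z \<in> carrier_vec k" "i < d"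
  shows "(B *\<^sub>v z) $ i = (\<Sum>j<k. B $$ (i, j) * z $ j)"
  using assms by (simp add: scalar_prod_def atLeast0LessThan)

text \<open>Cramer's rule for the normal equations \<open>B\<^sup>T B z = B\<^sup>T v\<close>, whose determinant is a nonzero integer.\<close>

lemma abs_close_coordinate_le:
  fixes B :: "int mat"
  assumes B: "B \<in> carrier_mat d k"
    and rank: "vec_space.rank d (map_mat real_of_int B) = k"
    and t: "t \<in> carrier_vec d" and z: "z \<in> carrier_vec k"
    and close: "sq_norm2 (B *\<^sub>v z - t) \<le> A"
    and A: "2 \<le> A" "int d \<le> A" "int k \<le> A"
    and entry: "\<And>i j. i < d \<Longrightarrow> j < k \<Longrightarrow> \<bar>B $$ (i, j)\<bar> \<le> A" "\<And>i. i < d \<Longrightarrow> \<bar>t $ i\<bar> \<le> A"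
    and j: "j < k"
  shows "\<bar>z $ j\<bar> \<le> A ^ (5 * k)"
proof -
  define G where "G = B\<^sup>T * B"
  have G: "G \<in> carrier_mat k k" using B by (simp add: G_def)
  have Gz: "G *\<^sub>v z = B\<^sup>T *\<^sub>v (B *\<^sub>v z)"
    unfolding G_def using B z by (metis assoc_mult_mat_vec transpose_carrier_mat)
  have v: "\<bar>(B *\<^sub>v z) $ i\<bar> \<le> A\<^sup>2" if i: "i < d" for i
  proof -
    have "\<bar>(B *\<^sub>v z - t) $ i\<bar> \<le> A"
      using abs_le_sq_norm2[of i "B *\<^sub>v z - t"] close i t by (auto intro: order_trans)
    then have "\<bar>(B *\<^sub>v z) $ i\<bar> \<le> 2 * A"
      using entry(2)[OF i] i t by simp
    also have "\<dots> \<le> A * A" using A(1) by (intro mult_right_mono) auto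
    finally show ?thesis by (simp add: power2_eq_square)
  qed
  \<comment> \<open>A sum over the \<open>d\<close> rows costs one more factor
    \<open>A\<close>.\<close>
  have le4: "x \<le> A ^ 4" if "x \<le> int d * A ^ n" "n \<le> 3" for x n
  proof -
    have "int d * A ^ n \<le> A * A ^ 3"
      using A that(2) by (intro mult_mono power_increasing) auto
    then show ?thesis using that(1) by (simp add: power_numeral_reduce)
  qed
  have Gentry: "\<bar>G $$ (a, b)\<bar> \<le> A ^ 4" if ab: "a < k" "b < k" for a b
  proof -
    have "G $$ (a, b) = (\<Sum>i<d. B $$ (i, a) * B $$ (i, b))"
      using B ab by (simp add: G_def scalar_prod_def atLeast0LessThan)
    also have "\<bar>\<dots>\<bar> \<le> int d * A ^ 2"
    proof (rule abs_sum_le_card)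
      fix i assume "i < d"
      then show "\<bar>B $$ (i, a) * B $$ (i, b)\<bar> \<le> A ^ 2"
        unfolding abs_mult power2_eq_square using entry(1) ab A(1) by (intro mult_mono) auto
    qed
    finally show ?thesis using le4[of _ 2] by simp
  qed
  have rhs: "\<bar>(G *\<^sub>v z) $ a\<bar> \<le> A ^ 4" if a: "a < k" for a
  proof -
    have "(G *\<^sub>v z) $ a = (\<Sum>i<d. B $$ (i, a) * (B *\<^sub>v z) $ i)"
      unfolding Gz using B z a
      by (subst mult_mat_vec_index_sum[of "B\<^sup>T" k d]) (auto intro!: sum.cong)
    also have "\<bar>\<dots>\<bar> \<le> int d * A ^ 3"
    proof (rule abs_sum_le_card)
      fix i assume "i < d"
      then have "\<bar>B $$ (i, a) * (B *\<^sub>v z) $ i\<bar> \<le> A * A\<^sup>2"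
        unfolding abs_mult using entry(1)[of i a] v[of i] a A(1) by (intro mult_mono) auto
      then show "\<bar>B $$ (i, a) * (B *\<^sub>v z) $ i\<bar> \<le> A ^ 3" by (simp add: power_numeral_reduce)
    qed
    finally show ?thesis using le4[of _ 3] by simp
  qed
  have det: "1 \<le> \<bar>det G\<bar>"
    using det_Gram_nonzero[OF B rank] unfolding G_def by simp
  \<comment> \<open>Multiplying by a nonzero integer cannot decrease the absolute value, so Cramer's
    rule is used without dividing by the determinant.\<close>
  have "\<bar>z $ j\<bar> \<le> \<bar>z $ j\<bar> * \<bar>det G\<bar>" using det by (simp add: mult_le_cancel_left1)
  also have "\<dots> = \<bar>det (replace_col G (G *\<^sub>v z) j)\<bar>"
    using cramer_lemma_mat[OF G z j] by (simp add: abs_mult)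
  also have "\<dots> \<le> fact k * (A ^ 4) ^ k"
  proof (rule abs_det_le)
    show "replace_col G (G *\<^sub>v z) j \<in> carrier_mat k k"
      using G by (simp add: replace_col_def)
    fix a b assume "a < k" "b < k"
    then show "\<bar>replace_col G (G *\<^sub>v z) j $$ (a, b)\<bar> \<le> A ^ 4"
      using Gentry rhs G by (simp add: replace_col_def)
  qed
  \<comment> \<open>\<open>k! \<le> k ^ k \<le> A ^ k\<close>: the factorial accounts for one of the
    five factors \<open>A\<close> per column.\<close>
  also have "\<dots> \<le> A ^ k * (A ^ 4) ^ k"
  proof (intro mult_right_mono)
    have "(fact k :: int) \<le> int k ^ k"
      using fact_le_power[of k, where 'a = int] by simp
    also have "\<dots> \<le> A ^ k" using A by (intro power_mono) auto
    finally show "fact k \<le> A ^ k" .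
  qed (use A in auto)
  also have "\<dots> = A ^ (5 * k)"
    by (simp flip: power_mult power_add)
  finally show ?thesis .
qed

section \<open>Merging \<open>d\<close> equations into one, and passing to the cap of a ball\<close>

lemma digits_zero:
  fixes e :: "nat \<Rightarrow> int"
  assumes "\<And>i. i < d \<Longrightarrow> \<bar>e i\<bar> < M" and "(\<Sum>i<d. M ^ i * e i) = 0" and "i < d"
  shows "e i = 0"
  using assms
proof (induction d arbitrary: e i)
  case (Suc d)
  let ?s = "\<Sum>i<d. M ^ i * e (Suc i)"
  have sum: "e 0 + M * ?s = 0"
    using Suc.prems(2) by (simp only: sum.lessThan_Suc_shift) (simp add: sum_distrib_left mult.assoc)
  \<comment> \<open>Uniqueness of signed base-\<open>M\<close> digits: modulo \<open>M\<close> only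
    the lowest digit is left, and a multiple of \<open>M\<close> below \<open>M\<close> in absolute
    value is 0. Dividing the sum by \<open>M\<close> leaves the same situation with one digit
    fewer.\<close>
  then have "M dvd e 0" by (metis dvd_add_right_iff dvd_triv_left add.commute dvd_0_right)
  moreover have "\<bar>e 0\<bar> < M" using Suc.prems(1) by simp
  ultimately have e0: "e 0 = 0" by (meson dvd_imp_le_int abs_ge_self linorder_not_less order_trans)
  moreover have "M \<noteq> 0" using Suc.prems(1)[of 0] by auto
  ultimately have "?s = 0" using sum by simp
  then have "e (Suc i') = 0" if "i' < d" for i'
    using Suc.IH[of "\<lambda>i. e (Suc i)" i'] Suc.prems(1) that by simp
  with e0 Suc.prems(3) show ?case by (cases i) auto
qed simp

text \<open>
  The points of the cap are \<open>W = K c + u\<close> with \<open>\<parallel>u\<parallel>\<^sup>2 + 2 K (c \<bullet> u - \<tau>) \<le> \<rho>\<close> and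
  \<open>c \<bullet> u \<ge> \<tau>\<close>; as \<open>2 K > \<rho>\<close>, the integer \<open>c \<bullet> u - \<tau>\<close> has to vanish.
\<close>

lemma cap_iff_hyperplane:
  fixes c :: "int vec"
  assumes c: "c \<in> carrier_vec N" and K: "\<rho> < 2 * K" "0 \<le> K"
  shows "(\<exists>W \<in> carrier_vec N. sq_norm2 W \<le> K\<^sup>2 * sq_norm2 c + 2 * K * \<tau> + \<rho> \<and>
            c \<bullet> W \<ge> K * sq_norm2 c + \<tau>) \<longleftrightarrow>
         (\<exists>u \<in> carrier_vec N. sq_norm2 u \<le> \<rho> \<and> c \<bullet> u = \<tau>)"
proof -
  have norm: "sq_norm2 (K \<cdot>\<^sub>v c + u) = K\<^sup>2 * sq_norm2 c + 2 * K * (c \<bullet> u) + sq_norm2 u"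
    and prod: "c \<bullet> (K \<cdot>\<^sub>v c + u) = K * sq_norm2 c + c \<bullet> u"
    if u: "u \<in> carrier_vec N" for u
  proof -
    have "u \<bullet> c = c \<bullet> u" using u c by (rule comm_scalar_prod)
    then show "sq_norm2 (K \<cdot>\<^sub>v c + u) = K\<^sup>2 * sq_norm2 c + 2 * K * (c \<bullet> u) + sq_norm2 u"
      using u c unfolding sq_norm2_def
      by (simp add: scalar_prod_add_distrib[of _ N] add_scalar_prod_distrib[of _ N]
          power2_eq_square algebra_simps)
    show "c \<bullet> (K \<cdot>\<^sub>v c + u) = K * sq_norm2 c + c \<bullet> u"
      using u c unfolding sq_norm2_def by (simp add: scalar_prod_add_distrib[of _ N])
  qed
  show ?thesis
  proof
    assume "\<exists>W \<in> carrier_vec N. sq_norm2 W \<le> K\<^sup>2 * sq_norm2 c + 2 * K * \<tau> + \<rho> \<and>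
            c \<bullet> W \<ge> K * sq_norm2 c + \<tau>"
    then obtain W where W: "W \<in> carrier_vec N"
      "sq_norm2 W \<le> K\<^sup>2 * sq_norm2 c + 2 * K * \<tau> + \<rho>" "c \<bullet> W \<ge> K * sq_norm2 c + \<tau>"
      by blast
    define u where "u = W - K \<cdot>\<^sub>v c"
    have u: "u \<in> carrier_vec N" using W(1) c by (simp add: u_def)
    have W_eq: "W = K \<cdot>\<^sub>v c + u" using W(1) c by (auto simp: u_def intro!: eq_vecI)
    have ge: "\<tau> \<le> c \<bullet> u" using W(3) prod[OF u] unfolding W_eq by simp
    have le: "2 * K * (c \<bullet> u - \<tau>) + sq_norm2 u \<le> \<rho>"
      using W(2) norm[OF u] unfolding W_eq by (simp add: algebra_simps)
    have "c \<bullet> u = \<tau>"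
    proof (rule ccontr)
      assume "c \<bullet> u \<noteq> \<tau>"
      with ge have "2 * K * 1 \<le> 2 * K * (c \<bullet> u - \<tau>)" using K by (intro mult_left_mono) auto
      then show False using le K sq_norm2_nonneg[of u] by simp
    qed
    with le u show "\<exists>u \<in> carrier_vec N. sq_norm2 u \<le> \<rho> \<and> c \<bullet> u = \<tau>" by auto
  next
    assume "\<exists>u \<in> carrier_vec N. sq_norm2 u \<le> \<rho> \<and> c \<bullet> u = \<tau>"
    then obtain u where u: "u \<in> carrier_vec N" "sq_norm2 u \<le> \<rho>" "c \<bullet> u = \<tau>" by blast
    then show "\<exists>W \<in> carrier_vec N. sq_norm2 W \<le> K\<^sup>2 * sq_norm2 c + 2 * K * \<tau> + \<rho> \<and>
            c \<bullet> W \<ge> K * sq_norm2 c + \<tau>"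
      using norm[OF u(1)] prod[OF u(1)] c by (intro bexI[of _ "K \<cdot>\<^sub>v c + u"]) auto
  qed
qed

text \<open>Coefficients of \<open>y\<close> and \<open>z\<close> in the sum of the residuals
  \<open>y\<^sub>i - S ((B z)\<^sub>i - t\<^sub>i)\<close> with weights \<open>M ^ i\<close>. The
  constant term of that sum, with opposite sign, is \<open>ball_offset\<close>.\<close>

definition ball_normal :: "int \<Rightarrow> int \<Rightarrow> int mat \<Rightarrow> int vec" where
  "ball_normal S M B = vec (dim_row B) (\<lambda>i. M ^ i) @\<^sub>v
     vec (dim_col B) (\<lambda>j. - (S * (\<Sum>i<dim_row B. M ^ i * B $$ (i, j))))"

definition ball_offset :: "int \<Rightarrow> int \<Rightarrow> int vec \<Rightarrow> int" where
  "ball_offset S M t = - (S * (\<Sum>i<dim_vec t. M ^ i * t $ i))"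

lemma ball_normal_carrier:
  "B \<in> carrier_mat d k \<Longrightarrow> ball_normal S M B \<in> carrier_vec (d + k)"
  by (auto simp: ball_normal_def)

lemma ball_normal_prod:
  assumes B: "B \<in> carrier_mat d k" and t: "t \<in> carrier_vec d"
    and y: "y \<in> carrier_vec d" and z: "z \<in> carrier_vec k"
  shows "ball_normal S M B \<bullet> (y @\<^sub>v z) - ball_offset S M t =
    (\<Sum>i<d. M ^ i * (y $ i - S * ((B *\<^sub>v z) $ i - t $ i)))"
proof -
  have "ball_normal S M B \<bullet> (y @\<^sub>v z) =
      vec d (\<lambda>i. M ^ i) \<bullet> y + vec k (\<lambda>j. - (S * (\<Sum>i<d. M ^ i * B $$ (i, j)))) \<bullet> z"
    using B y z unfolding ball_normal_def by (subst scalar_prod_append[of _ d _ k]) auto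
  also have "vec d (\<lambda>i. M ^ i) \<bullet> y = (\<Sum>i<d. M ^ i * y $ i)"
    using y by (simp add: scalar_prod_def atLeast0LessThan)
  also have "vec k (\<lambda>j. - (S * (\<Sum>i<d. M ^ i * B $$ (i, j)))) \<bullet> z =
      - (\<Sum>j<k. \<Sum>i<d. M ^ i * (S * (B $$ (i, j) * z $ j)))"
    using z by (simp add: scalar_prod_def atLeast0LessThan sum_distrib_left sum_distrib_right
        sum_negf algebra_simps)
  also have "(\<Sum>j<k. \<Sum>i<d. M ^ i * (S * (B $$ (i, j) * z $ j))) = (\<Sum>i<d. M ^ i * (S * (B *\<^sub>v z) $ i))"
    by (subst sum.swap) (simp add: mult_mat_vec_index_sum[OF B z] sum_distrib_left)
  finally show ?thesis
    using t by (simp add: ball_offset_def sum_distrib_left sum.distrib sum_subtractf algebra_simps)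
qed

lemma sq_norm2_append: "sq_norm2 (y @\<^sub>v z) = sq_norm2 y + sq_norm2 z"
  unfolding sq_norm2_def by (rule scalar_prod_append) (rule carrier_vec_dim_vec)+

lemma sq_norm2_smult: "sq_norm2 (a \<cdot>\<^sub>v y) = a\<^sup>2 * sq_norm2 y"
  by (simp add: sq_norm2_eq_sum power_mult_distrib sum_distrib_left)

text \<open>\<open>small\<close> and \<open>digits\<close> collect the demands on the sizes of
  \<open>S\<close> and \<open>M\<close>. The value of \<open>\<rho>\<close> works because
  \<open>S\<^sup>2 \<beta> + \<parallel>z\<parallel>\<^sup>2 < S\<^sup>2 (\<beta> + 1)\<close> for a
  solution \<open>z\<close>, while \<open>S\<^sup>2 \<parallel>B z - t\<parallel>\<^sup>2 <
  S\<^sup>2 (\<beta> + 1)\<close> forces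
  \<open>\<parallel>B z - t\<parallel>\<^sup>2 \<le> \<beta>\<close> by integrality.\<close>

lemma closest_vector_iff_hyperplane:
  assumes B: "B \<in> carrier_mat d k" and t: "t \<in> carrier_vec d"
    and rho: "\<rho> = S\<^sup>2 * (\<beta> + 1) - 1"
    and small: "\<And>z. z \<in> carrier_vec k \<Longrightarrow> sq_norm2 (B *\<^sub>v z - t) \<le> \<beta> \<Longrightarrow> sq_norm2 z < S\<^sup>2"
    and digits: "\<And>y z i. i < d \<Longrightarrow> z \<in> carrier_vec k \<Longrightarrow> \<bar>y\<bar> \<le> \<rho> \<Longrightarrow> (\<And>j. j < k \<Longrightarrow> \<bar>z $ j\<bar> \<le> \<rho>) \<Longrightarrow>
        \<bar>y - S * ((B *\<^sub>v z) $ i - t $ i)\<bar> < M"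
  shows "(\<exists>z \<in> carrier_vec k. sq_norm2 (B *\<^sub>v z - t) \<le> \<beta>) \<longleftrightarrow>
    (\<exists>u \<in> carrier_vec (d + k). sq_norm2 u \<le> \<rho> \<and> ball_normal S M B \<bullet> u = ball_offset S M t)"
proof
  assume "\<exists>z \<in> carrier_vec k. sq_norm2 (B *\<^sub>v z - t) \<le> \<beta>"
  then obtain z where z: "z \<in> carrier_vec k" and le: "sq_norm2 (B *\<^sub>v z - t) \<le> \<beta>" by blast
  let ?y = "S \<cdot>\<^sub>v (B *\<^sub>v z - t)"
  have y: "?y \<in> carrier_vec d" using B z t by simp
  have "sq_norm2 (?y @\<^sub>v z) \<le> \<rho>"
  proof -
    have "S\<^sup>2 * sq_norm2 (B *\<^sub>v z - t) \<le> S\<^sup>2 * \<beta>" using le by (intro mult_left_mono) auto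
    then show ?thesis
      using small[OF z le] by (simp add: sq_norm2_append sq_norm2_smult rho algebra_simps)
  qed
  moreover have "ball_normal S M B \<bullet> (?y @\<^sub>v z) = ball_offset S M t"
    using ball_normal_prod[OF B t y z, of S M] B t z by simp
  ultimately show "\<exists>u \<in> carrier_vec (d + k). sq_norm2 u \<le> \<rho> \<and>
      ball_normal S M B \<bullet> u = ball_offset S M t"
    using y z by (intro bexI[of _ "?y @\<^sub>v z"]) auto
next
  assume "\<exists>u \<in> carrier_vec (d + k). sq_norm2 u \<le> \<rho> \<and> ball_normal S M B \<bullet> u = ball_offset S M t"
  then obtain u where u: "u \<in> carrier_vec (d + k)" "sq_norm2 u \<le> \<rho>"
    "ball_normal S M B \<bullet> u = ball_offset S M t" by blast
  define y z where "y = vec_first u d" and "z = vec_last u k"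
  have y: "y \<in> carrier_vec d" and z: "z \<in> carrier_vec k" and u_eq: "u = y @\<^sub>v z"
    using u(1) by (auto simp: y_def z_def)
  have norm: "sq_norm2 y + sq_norm2 z \<le> \<rho>" using u(2) by (simp add: u_eq sq_norm2_append)
  have zero: "(\<Sum>i<d. M ^ i * (y $ i - S * ((B *\<^sub>v z) $ i - t $ i))) = 0"
    using ball_normal_prod[OF B t y z, of S M] u(3) by (simp add: u_eq)
  \<comment> \<open>An integer is bounded by its square, hence each coordinate by the squared norm;
    this makes all digits smaller than \<open>M\<close>.\<close>
  have "\<bar>y $ i\<bar> \<le> \<rho>" if "i < d" for i
    using abs_le_sq_norm2[of i y] that y norm sq_norm2_nonneg[of z] by auto
  moreover have "\<bar>z $ j\<bar> \<le> \<rho>" if "j < k" for j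
    using abs_le_sq_norm2[of j z] that z norm sq_norm2_nonneg[of y] by auto
  ultimately have "y $ i - S * ((B *\<^sub>v z) $ i - t $ i) = 0" if "i < d" for i
    using digits_zero[OF digits zero, of i] z that by blast
  then have "y = S \<cdot>\<^sub>v (B *\<^sub>v z - t)" using y B t by (intro eq_vecI) auto
  then have "S\<^sup>2 * sq_norm2 (B *\<^sub>v z - t) < S\<^sup>2 * (\<beta> + 1)"
    using norm sq_norm2_nonneg[of z] by (simp add: sq_norm2_smult rho)
  then have "sq_norm2 (B *\<^sub>v z - t) \<le> \<beta>" by (simp add: mult_less_cancel_left)
  with z show "\<exists>z \<in> carrier_vec k. sq_norm2 (B *\<^sub>v z - t) \<le> \<beta>" by blast
qed

section \<open>Choice of the parameters\<close>

definition magnitude :: "cvp_instance \<Rightarrow> int" where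
  "magnitude x = 1 + (\<Sum>a\<leftarrow>encode_cvp x. a\<^sup>2)"

lemma magnitude_ge_1: "1 \<le> magnitude x"
proof -
  have "0 \<le> (\<Sum>a\<leftarrow>encode_cvp x. a\<^sup>2)" by (intro sum_list_nonneg) auto
  then show ?thesis by (simp add: magnitude_def)
qed

text \<open>\<open>K \<ge> 1 + \<rho>\<close> makes the cap flat enough, and the summand
  \<open>\<tau>\<^sup>2\<close> keeps the squared radius nonnegative, since
  \<open>K + 2 \<tau> = \<rho> + (1 + \<tau>)\<^sup>2\<close>.\<close>

fun reduction :: "cvp_instance \<Rightarrow> ballip_instance" where
  "reduction (B, t, \<beta>) = (let
       S = magnitude (B, t, \<beta>) ^ (6 * dim_col B);
       M = S ^ 6;
       \<rho> = S\<^sup>2 * (\<beta> + 1) - 1;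
       c = ball_normal S M B;
       \<tau> = ball_offset S M t;
       K = 1 + \<rho> + \<tau>\<^sup>2
     in (c, K\<^sup>2 * sq_norm2 c + 2 * K * \<tau> + \<rho>, K * sq_norm2 c + \<tau>))"

declare reduction.simps [simp del]

lemma magnitude_bounds:
  assumes B: "B \<in> carrier_mat d k" and t: "t \<in> carrier_vec d" and "1 \<le> k" "k \<le> d" "0 \<le> \<beta>"
    and A: "A = magnitude (B, t, \<beta>)"
  shows "3 \<le> A" "int d < A" "int k < A" "\<beta> < A"
    "\<And>i j. i < d \<Longrightarrow> j < k \<Longrightarrow> \<bar>B $$ (i, j)\<bar> < A" "\<And>i. i < d \<Longrightarrow> \<bar>t $ i\<bar> < A"
proof -
  let ?xs = "encode_cvp (B, t, \<beta>)"
  have less: "\<bar>x\<bar> < A" if "x \<in> set ?xs" for x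
  proof -
    have "x\<^sup>2 \<le> (\<Sum>a\<leftarrow>?xs. a\<^sup>2)"
      by (rule member_le_sum_list) (use that in auto)
    then show ?thesis using abs_le_square_int[of x] unfolding A magnitude_def by linarith
  qed
  have d: "int d \<in> set ?xs" and k: "int k \<in> set ?xs" using B by auto
  show "int d < A" "int k < A" "\<beta> < A" using less[OF d] less[OF k] less[of \<beta>] by auto
  show "\<bar>B $$ (i, j)\<bar> < A" if "i < d" "j < k" for i j
    by (rule less) (use B that in \<open>auto simp: mat_to_list_def intro!: bexI[of _ i] imageI\<close>)
  show "\<bar>t $ i\<bar> < A" if "i < d" for i
    by (rule less) (use t that in \<open>auto simp: list_of_vec_map\<close>)
  \<comment> \<open>Both dimensions are at least 1 and occur among the input numbers.\<close>
  have "1 \<le> (int d)\<^sup>2" "1 \<le> (int k)\<^sup>2" using assms by (simp_all add: one_le_power)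
  moreover have "0 \<le> (\<Sum>a\<leftarrow>concat (mat_to_list B) @ list_of_vec t @ [\<beta>]. a\<^sup>2)"
    by (intro sum_list_nonneg) auto
  ultimately show "3 \<le> A" using B unfolding A magnitude_def by simp
qed

lemma reduction_correct:
  assumes B: "B \<in> carrier_mat d k" and t: "t \<in> carrier_vec d" and k: "1 \<le> k" "k \<le> d"
    and beta: "0 \<le> \<beta>" and rank: "vec_space.rank d (map_mat real_of_int B) = k"
    and red: "reduction (B, t, \<beta>) = (c, r2, \<Gamma>)"
  shows "c \<in> carrier_vec (d + k)" "0 \<le> r2"
    "(\<exists>z \<in> carrier_vec k. sq_norm2 (B *\<^sub>v z - t) \<le> \<beta>) \<longleftrightarrow>
           (\<exists>W \<in> carrier_vec (d + k). sq_norm2 W \<le> r2 \<and> c \<bullet> W \<ge> \<Gamma>)"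
proof -
  define A where "A = magnitude (B, t, \<beta>)"
  define S where "S = A ^ (6 * k)"
  define M where "M = S ^ 6"
  define \<rho> where "\<rho> = S\<^sup>2 * (\<beta> + 1) - 1"
  define \<tau> where "\<tau> = ball_offset S M t"
  define K where "K = 1 + \<rho> + \<tau>\<^sup>2"
  have c: "c = ball_normal S M B" and r2: "r2 = K\<^sup>2 * sq_norm2 c + 2 * K * \<tau> + \<rho>"
    and \<Gamma>: "\<Gamma> = K * sq_norm2 c + \<tau>"
    using red B unfolding A_def S_def M_def \<rho>_def \<tau>_def K_def by (auto simp: Let_def reduction.simps)
  note A = magnitude_bounds[OF B t k beta A_def]
  show c_carrier: "c \<in> carrier_vec (d + k)" unfolding c using B by (rule ball_normal_carrier)
  have AS: "A\<^sup>2 \<le> S" unfolding S_def using A k by (intro power_increasing) auto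
  have "A * 1 \<le> A * A" using A by (intro mult_left_mono) auto
  then have AS1: "A \<le> S" using AS by (simp add: power2_eq_square)
  then have S3: "3 \<le> S" and S1: "1 \<le> S" using A(1) by simp_all
  have "1 * 1 \<le> S\<^sup>2 * (\<beta> + 1)" using S1 beta by (intro mult_mono) (auto simp: one_le_power)
  then have rho: "0 \<le> \<rho>" by (simp add: \<rho>_def)
  have tau: "0 \<le> K + 2 * \<tau>"
  proof -
    have "0 \<le> (1 + \<tau>)\<^sup>2" by simp
    then show ?thesis using rho by (simp add: K_def power2_eq_square algebra_simps)
  qed
  have "1 + \<rho> \<le> K" unfolding K_def by simp
  then have K: "0 \<le> K" "\<rho> < 2 * K" using rho by simp_all
  \<comment> \<open>The weight of the first equation is \<open>M ^ 0 = 1\<close>, so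
    \<open>c\<close> has an entry 1. Hence the squared radius is at least
    \<open>K (K + 2 \<tau>) + \<rho>\<close>.\<close>
  have "1 \<le> sq_norm2 c"
    using square_le_sq_norm2[of 0 c] c_carrier k B unfolding c by (simp add: ball_normal_def)
  then have "K\<^sup>2 * 1 \<le> K\<^sup>2 * sq_norm2 c" by (intro mult_left_mono) auto
  moreover have "0 \<le> K * (K + 2 * \<tau>)" using K tau by simp
  ultimately show "0 \<le> r2" using rho unfolding r2 by (simp add: power2_eq_square algebra_simps)
  have "(\<exists>z \<in> carrier_vec k. sq_norm2 (B *\<^sub>v z - t) \<le> \<beta>) \<longleftrightarrow>
      (\<exists>u \<in> carrier_vec (d + k). sq_norm2 u \<le> \<rho> \<and> ball_normal S M B \<bullet> u = ball_offset S M t)"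
  proof (rule closest_vector_iff_hyperplane[OF B t \<rho>_def])
    fix z assume z: "z \<in> carrier_vec k" and le: "sq_norm2 (B *\<^sub>v z - t) \<le> \<beta>"
    have "\<bar>z $ j\<bar> \<le> A ^ (5 * k)" if "j < k" for j
      using A le by (intro abs_close_coordinate_le[OF B rank t z _ _ _ _ _ _ that]) (auto intro: less_imp_le)
    then have "(z $ j)\<^sup>2 \<le> (A ^ (5 * k))\<^sup>2" if "j < k" for j
      using that by (meson abs_le_square_iff abs_ge_self order_trans)
    then have "\<bar>\<Sum>j<k. (z $ j)\<^sup>2\<bar> \<le> int k * (A ^ (5 * k))\<^sup>2"
      by (intro abs_sum_le_card) auto
    \<comment> \<open>\<open>k * A ^ (10 * k) < A ^ (10 * k + 1) \<le> A ^ (12 * k) = S ^ 2\<close>,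
      where \<open>k \<ge> 1\<close> enters. This accounts for the exponent \<open>6 * k\<close> of
      \<open>S\<close>.\<close>
    then have "sq_norm2 z \<le> int k * (A ^ (5 * k))\<^sup>2" using z by (simp add: sq_norm2_eq_sum)
    also have "\<dots> < A * (A ^ (5 * k))\<^sup>2" using A by (intro mult_strict_right_mono) auto
    also have "\<dots> = A ^ (10 * k + 1)" by (simp add: power_mult[symmetric] mult.commute)
    also have "\<dots> \<le> A ^ (6 * k * 2)" using A k by (intro power_increasing) auto
    also have "\<dots> = S\<^sup>2" by (simp only: S_def power_mult)
    finally show "sq_norm2 z < S\<^sup>2" .
  next
    fix y :: int and z :: "int vec" and i
    assume i: "i < d" and z: "z \<in> carrier_vec k" and y: "\<bar>y\<bar> \<le> \<rho>"
      and zj: "\<And>j. j < k \<Longrightarrow> \<bar>z $ j\<bar> \<le> \<rho>"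
    \<comment> \<open>Size of a digit: \<open>\<rho> \<le> S ^ 3\<close>, and a row of
      \<open>B\<close> contributes at most \<open>A ^ 2 * \<rho> \<le> S ^ 4\<close>, so the digit
      is at most \<open>S ^ 5 + S ^ 3 + S ^ 2 < 3 * S ^ 5 \<le> S ^ 6\<close>. This explains
      \<open>M = S ^ 6\<close>.\<close>
    have "S\<^sup>2 * (\<beta> + 1) \<le> S\<^sup>2 * A" using A(4) by (intro mult_left_mono) auto
    then have "\<rho> \<le> S\<^sup>2 * A" unfolding \<rho>_def by simp
    also have "\<dots> \<le> S\<^sup>2 * S" using AS1 by (intro mult_left_mono) auto
    finally have rho_le: "\<rho> \<le> S ^ 3" by (simp add: power_numeral_reduce)
    have "\<bar>\<Sum>j<k. B $$ (i, j) * z $ j\<bar> \<le> int k * (A * \<rho>)"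
    proof (rule abs_sum_le_card)
      fix j assume "j < k"
      then show "\<bar>B $$ (i, j) * z $ j\<bar> \<le> A * \<rho>"
        unfolding abs_mult using A(1) A(5)[OF i] zj by (intro mult_mono) (auto intro: less_imp_le)
    qed
    also have "\<dots> \<le> A * (A * \<rho>)" using A rho by (intro mult_right_mono) auto
    also have "\<dots> \<le> S * S ^ 3"
      using AS rho_le rho S1 unfolding mult.assoc[symmetric] power2_eq_square
      by (intro mult_mono) auto
    finally have "\<bar>(B *\<^sub>v z) $ i - t $ i\<bar> \<le> S * S ^ 3 + S"
      unfolding mult_mat_vec_index_sum[OF B z i] using A(6)[OF i] AS1 by linarith
    then have "\<bar>S * ((B *\<^sub>v z) $ i - t $ i)\<bar> \<le> S * (S * S ^ 3 + S)"
      unfolding abs_mult using S1 by (intro mult_mono) auto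
    then have "\<bar>y - S * ((B *\<^sub>v z) $ i - t $ i)\<bar> \<le> S ^ 3 + (S ^ 5 + S ^ 2)"
      using y rho_le abs_triangle_ineq4[of y "S * ((B *\<^sub>v z) $ i - t $ i)"]
      by (simp add: algebra_simps power_numeral_reduce)
    also have "\<dots> < 3 * S ^ 5"
    proof -
      have "S ^ 3 < S ^ 5" "S ^ 2 < S ^ 5" using S3 by (intro power_strict_increasing; simp)+
      then show ?thesis by linarith
    qed
    also have "\<dots> \<le> S * S ^ 5" using S3 by (intro mult_right_mono) auto
    also have "\<dots> = M" by (simp add: M_def power_numeral_reduce)
    finally show "\<bar>y - S * ((B *\<^sub>v z) $ i - t $ i)\<bar> < M" .
  qed
  also have "\<dots> \<longleftrightarrow> (\<exists>W \<in> carrier_vec (d + k). sq_norm2 W \<le> r2 \<and> c \<bullet> W \<ge> \<Gamma>)"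
    using cap_iff_hyperplane[OF c_carrier K(2) K(1), of \<tau>] unfolding r2 \<Gamma> \<tau>_def c by simp
  finally show "(\<exists>z \<in> carrier_vec k. sq_norm2 (B *\<^sub>v z - t) \<le> \<beta>) \<longleftrightarrow>
      (\<exists>W \<in> carrier_vec (d + k). sq_norm2 W \<le> r2 \<and> c \<bullet> W \<ge> \<Gamma>)" .
qed

section \<open>A program for the reduction\<close>

abbreviation Seq_infix :: "program \<Rightarrow> program \<Rightarrow> program" (infixr \<open>;;\<close> 60) where
  "P ;; Q \<equiv> Seq P Q"

text \<open>Scalars use the negative addresses, which the input array, growing upwards from 0, never
  reaches.\<close>

definition cell :: "nat \<Rightarrow> expr" where
  "cell n = Const (- 1 - int n)"

definition var :: "nat \<Rightarrow> expr" where
  "var n = Mem (cell n)"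

definition assign :: "nat \<Rightarrow> expr \<Rightarrow> program" where
  "assign n e = Store (cell n) e"

text \<open>The default 0 makes the initial memory an instance, with \<open>xs\<close>
  empty.\<close>

definition store :: "int list \<Rightarrow> int list \<Rightarrow> memory" where
  "store xs vs a =
     (if 0 \<le> a then (if nat a < length xs then xs ! nat a else 0)
      else if nat (- 1 - a) < length vs then vs ! nat (- 1 - a) else 0)"

lemma expr_value_cell [simp]: "expr_value m (cell n) = - 1 - int n"
  by (simp add: cell_def)

lemma expr_value_var [simp]:
  "n < length vs \<Longrightarrow> expr_value (store xs vs) (var n) = vs ! n"
  by (simp add: var_def store_def)

lemma store_input [simp]:
  "0 \<le> a \<Longrightarrow> nat a < length xs \<Longrightarrow> store xs vs a = xs ! nat a"
  by (simp add: store_def)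

lemma store_update: "n < length vs \<Longrightarrow> (store xs vs)(- 1 - int n := v) = store xs (vs[n := v])"
  by (auto simp: store_def fun_eq_iff nth_list_update)

lemma list_update_Cons_numeral [simp]:
  "(x # xs)[numeral n := v] = x # xs[pred_numeral n := v]"
  by (simp add: numeral_eq_Suc)

lemma store_append: "(store xs vs)(int (length xs) := x) = store (xs @ [x]) vs"
  by (auto simp: store_def fun_eq_iff nth_append)

lemma runs_assign:
  assumes "n < length vs" "expr_value (store xs vs) e = v" "\<bar>v\<bar> \<le> H" "vs[n := v] = vs'"
  shows "runs H (assign n e) (store xs vs, is, os) 1 (store xs vs', is, os)"
  using runs_Store[of "store xs vs" "cell n" "- 1 - int n" e v H] assms
  by (simp add: assign_def store_update)

text \<open>Continuation form: applied repeatedly, such rules execute a program symbolically, and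
  the bound on the stored value is the only substantial goal left.\<close>

lemma runs_assign_Seq:
  assumes "n < length vs" "expr_value (store xs vs) e = v" "\<bar>v\<bar> \<le> H"
    and "runs H P (store xs (vs[n := v]), is, os) t s"
  shows "runs H (assign n e ;; P) (store xs vs, is, os) (1 + t) s"
  by (rule runs_Seq[OF runs_assign assms(4)]) (use assms in auto)

lemma runs_Emit_Seq:
  assumes "expr_value m e = v" and "runs H P (m, is, os @ [v]) t s"
  shows "runs H (Emit e ;; P) (m, is, os) (1 + t) s"
  by (rule runs_Seq[OF runs_Emit assms(2)]) (use assms in auto)

lemma runs_Read_Seq:
  assumes "expr_value (store xs vs) e = int (length xs)"
    and "runs H P (store (xs @ [x]) vs, is, os) t s"
  shows "runs H (Read e ;; P) (store xs vs, x # is, os) (1 + t) s"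
  using runs_Seq[OF runs_Read[OF assms(1), unfolded store_append] assms(2)] .

lemma runs_mono: "runs H P s t s' \<Longrightarrow> t \<le> t' \<Longrightarrow> runs H P s t' s'"
  unfolding runs_def by (meson le_trans mult_le_mono1)

lemma runs_end: "runs H P s t s' \<Longrightarrow> s' = s1 \<Longrightarrow> runs H P s t s1"
  by simp

lemma runs_start: "runs H P s t s' \<Longrightarrow> s = s0 \<Longrightarrow> runs H P s0 t s'"
  by simp

text \<open>
  The input, which starts with the dimensions \<open>d\<close> and \<open>k\<close>, is kept at the addresses \<open>0, 1, \<dots>\<close>.
  The ten scalar cells hold: a counter, \<open>A\<close>, \<open>S\<close>, \<open>M\<close>, \<open>\<rho>\<close>, a power of \<open>M\<close>, the partial sums of
  \<open>\<parallel>c\<parallel>\<^sup>2\<close>, a second counter (finally \<open>\<tau>\<close>), the result of \<open>weighted_sum\<close>, and \<open>K\<close>.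
\<close>

abbreviation (input) dim_d :: expr where "dim_d \<equiv> Mem (Const 0)"
abbreviation (input) dim_k :: expr where "dim_k \<equiv> Mem (Const 1)"

text \<open>\<open>a\<close> is an address expression evaluated anew in each round; it may use the
  counter in cell 0, so one loop serves the columns of \<open>B\<close> and the vector
  \<open>t\<close>.\<close>

definition weighted_sum :: "expr \<Rightarrow> program" where
  "weighted_sum a =
     assign 5 (Const 1) ;; assign 8 (Const 0) ;; assign 0 (Const 0) ;;
     WhilePos (Sub dim_d (var 0))
       (assign 8 (Add (var 8) (Mul (var 5) (Mem a))) ;;
        assign 5 (Mul (var 5) (var 3)) ;;
        assign 0 (Add (var 0) (Const 1)))"

text \<open>The counter starts at 2, since the dimensions have been read before, and doubles as the
  target address; \<open>d * k + d + 3\<close> is the total number of input entries.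
  \<open>A\<close> is accumulated on the way.\<close>

definition read_input :: program where
  "read_input =
     WhilePos (Sub (Add (Add (Mul dim_d dim_k) dim_d) (Const 3)) (var 0))
       (Read (var 0) ;;
        assign 1 (Add (var 1) (Mul (Mem (var 0)) (Mem (var 0)))) ;;
        assign 0 (Add (var 0) (Const 1)))"

definition compute_power :: program where
  "compute_power =
     WhilePos (Sub (Mul (Const 6) dim_k) (var 0))
       (assign 2 (Mul (var 2) (var 1)) ;; assign 0 (Add (var 0) (Const 1)))"

definition emit_powers :: program where
  "emit_powers =
     WhilePos (Sub dim_d (var 0))
       (Emit (var 5) ;;
        assign 6 (Add (var 6) (Mul (var 5) (var 5))) ;;
        assign 5 (Mul (var 5) (var 3)) ;;
        assign 0 (Add (var 0) (Const 1)))"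

text \<open>\<open>B\<close> lies row by row behind the two dimensions, whence the address
  \<open>2 + i * k + j\<close>. The column index sits in cell 7 because \<open>weighted_sum\<close>
  overwrites cells 0, 5 and 8.\<close>

definition emit_columns :: program where
  "emit_columns =
     WhilePos (Sub dim_k (var 7))
       (weighted_sum (Add (Add (Const 2) (Mul (var 0) dim_k)) (var 7)) ;;
        Emit (Sub (Const 0) (Mul (var 2) (var 8))) ;;
        assign 6 (Add (var 6) (Mul (Mul (var 2) (var 8)) (Mul (var 2) (var 8)))) ;;
        assign 7 (Add (var 7) (Const 1)))"

text \<open>The last input entry, at address \<open>d * k + d + 2\<close>, is
  \<open>\<beta>\<close>. The vector \<open>c\<close> is emitted while its squared norm is
  accumulated, as the radius and \<open>\<Gamma>\<close>, which need the norm, come last in the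
  encoding.\<close>

definition reduction_program :: program where
  "reduction_program =
     Read (Const 0) ;; Read (Const 1) ;;
     assign 1 (Add (Const 1) (Add (Mul dim_d dim_d) (Mul dim_k dim_k))) ;;
     assign 0 (Const 2) ;; read_input ;;
     assign 2 (Const 1) ;; assign 0 (Const 0) ;; compute_power ;;
     assign 3 (Mul (Mul (Mul (var 2) (var 2)) (Mul (var 2) (var 2))) (Mul (var 2) (var 2))) ;;
     assign 4 (Sub (Mul (Mul (var 2) (var 2))
       (Add (Mem (Add (Add (Mul dim_d dim_k) dim_d) (Const 2))) (Const 1))) (Const 1)) ;;
     Emit (Add dim_d dim_k) ;;
     assign 5 (Const 1) ;; assign 6 (Const 0) ;; assign 0 (Const 0) ;; emit_powers ;;
     assign 7 (Const 0) ;; emit_columns ;;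
     weighted_sum (Add (Add (Const 2) (Mul dim_d dim_k)) (var 0)) ;;
     assign 7 (Sub (Const 0) (Mul (var 2) (var 8))) ;;
     assign 9 (Add (Add (Const 1) (var 4)) (Mul (var 7) (var 7))) ;;
     Emit (Add (Add (Mul (Mul (var 9) (var 9)) (var 6)) (Mul (Mul (Const 2) (var 9)) (var 7))) (var 4)) ;;
     Emit (Add (Mul (var 9) (var 6)) (var 7))"

section \<open>Bounds on all stored values, and the runs of the loops\<close>

lemma sum_power_le:
  fixes M :: int
  assumes "1 \<le> M" "r \<le> d" "\<And>i. i < d \<Longrightarrow> \<bar>b i\<bar> \<le> C"
  shows "\<bar>\<Sum>i<r. M ^ i * b i\<bar> \<le> int d * (M ^ d * C)"
\<comment> \<open>That \<open>C\<close> is nonnegative is known only when some index lies below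
  \<open>d\<close>.\<close>
proof (cases "r = 0")
  case False
  then have C: "0 \<le> C" using assms(2) assms(3)[of 0] by simp
  have "\<bar>\<Sum>i<r. M ^ i * b i\<bar> \<le> int r * (M ^ d * C)"
  proof (rule abs_sum_le_card)
    fix i assume "i < r"
    then show "\<bar>M ^ i * b i\<bar> \<le> M ^ d * C"
      unfolding abs_mult using assms C
      by (intro mult_mono) (auto simp: power_increasing)
  qed
  also have "\<dots> \<le> int d * (M ^ d * C)"
    using assms C by (intro mult_right_mono) auto
  finally show ?thesis .
next
  case True
  have "0 \<le> int d * (M ^ d * C)"
  proof (cases "d = 0")
    case False
    then have "0 \<le> C" using assms(3)[of 0] by simp
    then show ?thesis using assms(1) by simp
  qed simp
  with True show ?thesis by simp
qed

text \<open>\<open>X\<close> bounds the weighted sums even after scaling by \<open>S\<close>, and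
  \<open>H\<close> bounds everything stored during the run. The last two outputs are emitted without
  being stored, so they are not subject to \<open>H\<close>.\<close>

locale reduction_run =
  fixes d k :: nat and xs :: "int list" and A S M X H :: int
  assumes dims: "1 \<le> k" "k \<le> d"
    and length_xs: "length xs = d * k + d + 3"
    and head: "xs ! 0 = int d" "xs ! 1 = int k"
    and beta: "0 \<le> last xs"
    and A_def: "A = 1 + (\<Sum>x\<leftarrow>xs. x\<^sup>2)"
    and S_def: "S = A ^ (6 * k)" and M_def: "M = S ^ 6"
    and X_def: "X = M ^ (d + 1)" and H_def: "H = X ^ 3"
begin

lemma entry_less: "x \<in> set xs \<Longrightarrow> \<bar>x\<bar> < A"
proof -
  assume "x \<in> set xs"
  then have "x\<^sup>2 \<le> (\<Sum>x\<leftarrow>xs. x\<^sup>2)" by (intro member_le_sum_list) auto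
  then show ?thesis using abs_le_square_int[of x] unfolding A_def by linarith
qed

lemma dims_less: "int d < A" "int k < A"
  using entry_less[OF nth_mem, of 0] entry_less[OF nth_mem, of 1] head length_xs by auto

lemma A_ge: "3 \<le> A"
proof -
  obtain x y zs where xs: "xs = x # y # zs"
    using length_xs by (metis Suc_le_length_iff add.commute le_add1 numeral_3_eq_3)
  have "1 \<le> x\<^sup>2" "1 \<le> y\<^sup>2" using head dims unfolding xs by (auto simp: one_le_power)
  moreover have "0 \<le> (\<Sum>x\<leftarrow>zs. x\<^sup>2)" by (intro sum_list_nonneg) auto
  ultimately show ?thesis unfolding A_def xs by simp
qed

lemma S_ge: "A ^ n \<le> S" if "n \<le> 6"
  unfolding S_def using A_ge dims that by (intro power_increasing) auto

lemma S_le_M: "S ^ n \<le> M" if "n \<le> 6"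
  unfolding M_def using S_ge[of 0] that by (intro power_increasing) auto

lemma M_le_X: "M ^ n \<le> X" if "n \<le> d + 1"
  unfolding X_def using S_le_M[of 0] that by (intro power_increasing) auto

lemma X_le_H: "X ^ n \<le> H" if "n \<le> 3"
  unfolding H_def using M_le_X[of 0] that by (intro power_increasing) auto

lemma basic_bounds: "A \<le> S" "S \<le> M" "M \<le> X" "X \<le> H"
  using S_ge[of 1] S_le_M[of 1] M_le_X[of 1] X_le_H[of 1] by auto

lemma H_ge: "1 \<le> H" "0 \<le> H"
  using X_le_H[of 0] by simp_all

lemma counter_le: "i \<le> length xs \<Longrightarrow> int i \<le> H" "i \<le> 6 * k \<Longrightarrow> int i \<le> H"
proof -
  have A2: "A * 3 \<le> A * A" using A_ge by (intro mult_left_mono) auto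
  \<comment> \<open>\<open>(A - 1)\<^sup>2 + (A - 1) + 3 \<le> A\<^sup>2\<close> because
    \<open>A \<ge> 3\<close>.\<close>
  have "int d * int k \<le> (A - 1) * (A - 1)" using dims_less A_ge by (intro mult_mono) auto
  then have "int (length xs) \<le> A * A"
    using dims_less A_ge unfolding length_xs by (simp add: algebra_simps)
  then show "i \<le> length xs \<Longrightarrow> int i \<le> H"
    using S_ge[of 2] basic_bounds by (simp add: power2_eq_square)
  have "A * 3 * 3 \<le> A * A * A" using A2 A_ge by (intro mult_mono) auto
  then have "6 * int k \<le> A * A * A" using dims_less A_ge by linarith
  then show "i \<le> 6 * k \<Longrightarrow> int i \<le> H"
    using S_ge[of 3] basic_bounds by (simp add: power3_eq_cube)
qed

text \<open>There are at most \<open>d < A\<close> terms, each at most \<open>M ^ d * A\<close>.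
  With the factor \<open>S\<close> this gives \<open>S * A\<^sup>2 * M ^ d\<close>, and
  \<open>A\<^sup>2 \<le> S\<close>, \<open>S\<^sup>2 \<le> M\<close> turn the rest into one more
  power of \<open>M\<close>. Partial sums are included because the loop stores them.\<close>

lemma weighted_sum_bound:
  assumes "\<And>i. i < d \<Longrightarrow> b i \<in> set xs" "r \<le> d"
  shows "\<bar>S * (\<Sum>i<r. M ^ i * b i)\<bar> \<le> X"
proof -
  have "\<bar>\<Sum>i<r. M ^ i * b i\<bar> \<le> int d * (M ^ d * A)"
    using S_le_M[of 0] assms entry_less by (intro sum_power_le) (auto intro: less_imp_le)
  also have "\<dots> \<le> A * (M ^ d * A)"
    using dims_less A_ge S_le_M[of 0] by (intro mult_right_mono) auto
  finally have "\<bar>S * (\<Sum>i<r. M ^ i * b i)\<bar> \<le> S * (A * (M ^ d * A))"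
    unfolding abs_mult using S_ge[of 0] by (intro mult_mono) auto
  also have "\<dots> = S * A ^ 2 * M ^ d" by (simp add: power2_eq_square algebra_simps)
  also have "\<dots> \<le> S * S * M ^ d"
    using S_ge[of 2] S_ge[of 0] S_le_M[of 0] by (intro mult_right_mono mult_left_mono) auto
  also have "\<dots> \<le> M * M ^ d"
    using S_le_M[of 2] S_le_M[of 0] by (intro mult_right_mono) (auto simp: power2_eq_square)
  finally show ?thesis by (simp add: X_def)
qed

lemma weighted_sum_bounded:
  assumes "\<And>i. i < d \<Longrightarrow> b i \<in> set xs" "r \<le> d"
  shows "\<bar>\<Sum>i<r. M ^ i * b i\<bar> \<le> H"
proof -
  have "\<bar>\<Sum>i<r. M ^ i * b i\<bar> * 1 \<le> \<bar>\<Sum>i<r. M ^ i * b i\<bar> * \<bar>S\<bar>"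
    using S_ge[of 0] by (intro mult_left_mono) auto
  also have "\<dots> \<le> X" using weighted_sum_bound[of b r, OF assms] by (simp add: abs_mult mult.commute)
  finally show ?thesis using basic_bounds by simp
qed

lemma power_M_bound: "i \<le> d \<Longrightarrow> \<bar>M ^ i\<bar> \<le> H"
  using M_le_X[of i] S_le_M[of 0] basic_bounds by simp

text \<open>Cells 5 and 8 change inside the loop, so the value read may depend on the counter but
  not on them; hence the quantified \<open>w\<close> and \<open>c\<close>. The count is three
  assignments, \<open>d\<close> rounds of four steps and the failing test.\<close>

lemma runs_weighted_sum:
  assumes b: "\<And>i w c. i < d \<Longrightarrow>
      expr_value (store xs [int i, A, S, M, r, w, q, j, c, z]) (Mem a) = b i"
    and mem: "\<And>i. i < d \<Longrightarrow> b i \<in> set xs"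
  shows "runs H (weighted_sum a) (store xs [i0, A, S, M, r, w0, q, j, c0, z], is, os) (4 * d + 4)
    (store xs [int d, A, S, M, r, M ^ d, q, j, \<Sum>i<d. M ^ i * b i, z], is, os)"
proof -
  let ?s = "\<lambda>i. (store xs [int i, A, S, M, r, M ^ i, q, j, \<Sum>l<i. M ^ l * b l, z], is, os)"
  have d: "nat 0 < length xs" using length_xs by simp
  have "runs H (WhilePos (Sub dim_d (var 0))
       (assign 8 (Add (var 8) (Mul (var 5) (Mem a))) ;;
        assign 5 (Mul (var 5) (var 3)) ;;
        assign 0 (Add (var 0) (Const 1)))) (?s 0) (d * ((1 + (1 + 1)) + 1) + 1) (?s d)"
  proof (rule runs_While)
    fix i assume i: "i < d"
    show "0 < expr_value (fst (?s i)) (Sub dim_d (var 0))" using i d by (simp add: head)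
    show "runs H (assign 8 (Add (var 8) (Mul (var 5) (Mem a))) ;;
        assign 5 (Mul (var 5) (var 3)) ;;
        assign 0 (Add (var 0) (Const 1))) (?s i) (1 + (1 + 1)) (?s (Suc i))"
      apply (rule runs_assign_Seq)
         apply simp
        apply (simp add: b[OF i, simplified])
      subgoal using weighted_sum_bounded[of b "Suc i", OF mem] i by simp
      apply (rule runs_assign_Seq)
         apply simp
        apply simp
      subgoal using power_M_bound[of "Suc i"] i by (simp add: mult.commute)
      apply (rule runs_assign)
         apply simp
        apply simp
      subgoal using counter_le(1)[of "Suc i"] i length_xs by simp
      apply (simp add: algebra_simps)
      done
  qed (use d in \<open>simp add: head\<close>)
  note loop = this
  show ?thesis unfolding weighted_sum_def
    apply (rule runs_mono)
     apply (rule runs_assign_Seq, simp, simp, simp add: H_ge)+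
     apply (rule runs_start[OF loop])
     apply simp
    apply simp
    done
qed

lemma runs_read_input:
  "runs H read_input (store (take 2 xs) (2 # (1 + (\<Sum>x\<leftarrow>take 2 xs. x\<^sup>2)) # vs), drop 2 xs, [])
     (4 * length xs) (store xs (int (length xs) # A # vs), [], [])"
proof -
  \<comment> \<open>Before round \<open>i\<close> exactly \<open>i + 2\<close> entries have been
    read and accumulated; the shift accounts for the two dimensions.\<close>
  let ?s = "\<lambda>i. (store (take (Suc (Suc i)) xs)
      (int (Suc (Suc i)) # (1 + (\<Sum>x\<leftarrow>take (Suc (Suc i)) xs. x\<^sup>2)) # vs), drop (Suc (Suc i)) xs, [])"
  let ?r = "length xs - 2"
  have test: "expr_value (store (take (Suc (Suc i)) xs) (int (Suc (Suc i)) # vs'))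
      (Sub (Add (Add (Mul dim_d dim_k) dim_d) (Const 3)) (var 0)) = int (length xs) - int (Suc (Suc i))"
    if "i \<le> ?r" for i vs'
    using that length_xs head by simp
  have "runs H read_input (?s 0) (?r * ((1 + (1 + 1)) + 1) + 1) (?s ?r)"
    unfolding read_input_def
  proof (rule runs_While)
    fix i assume i: "i < ?r"
    then have i': "Suc (Suc i) < length xs" by simp
    show "0 < expr_value (fst (?s i)) (Sub (Add (Add (Mul dim_d dim_k) dim_d) (Const 3)) (var 0))"
      using i' test[of i] i by simp
    let ?x = "xs ! Suc (Suc i)"
    have drop: "drop (Suc (Suc i)) xs = ?x # drop (Suc (Suc (Suc i))) xs"
      using i' by (simp add: Cons_nth_drop_Suc)
    have take: "take (Suc (Suc (Suc i))) xs = take (Suc (Suc i)) xs @ [?x]"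
      using i' by (rule take_Suc_conv_app_nth)
    \<comment> \<open>Squares are nonnegative, so every intermediate value is at most the final
      one.\<close>
    have sum: "1 + (\<Sum>x\<leftarrow>take n xs. x\<^sup>2) \<le> A" "0 \<le> (\<Sum>x\<leftarrow>take n xs. x\<^sup>2)" for n
    proof -
      show "0 \<le> (\<Sum>x\<leftarrow>take n xs. x\<^sup>2)" by (intro sum_list_nonneg) auto
      have "0 \<le> (\<Sum>x\<leftarrow>drop n xs. x\<^sup>2)" by (intro sum_list_nonneg) auto
      moreover have "(\<Sum>x\<leftarrow>xs. x\<^sup>2) = (\<Sum>x\<leftarrow>take n xs. x\<^sup>2) + (\<Sum>x\<leftarrow>drop n xs. x\<^sup>2)"
        by (metis append_take_drop_id map_append sum_list_append)
      ultimately show "1 + (\<Sum>x\<leftarrow>take n xs. x\<^sup>2) \<le> A" by (simp add: A_def)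
    qed
    show "runs H (Read (var 0) ;;
        assign 1 (Add (var 1) (Mul (Mem (var 0)) (Mem (var 0)))) ;;
        assign 0 (Add (var 0) (Const 1))) (?s i) (1 + (1 + 1)) (?s (Suc i))"
      unfolding drop
      apply (rule runs_Read_Seq)
      subgoal using i' by simp
      unfolding take[symmetric]
      supply nat_add_distrib[simp]
      apply (rule runs_assign_Seq)
         apply simp
        apply (rule refl)
      subgoal using sum[of "Suc (Suc (Suc i))"] basic_bounds i' unfolding take
        by (simp add: power2_eq_square nth_append)
      apply (rule runs_assign)
         apply simp
        apply simp
      subgoal using counter_le(1)[of "Suc (Suc (Suc i))"] i' by simp
      using i' unfolding take apply (simp add: power2_eq_square nth_append)
      done
  qed (use test[of ?r] length_xs in simp)
  moreover have "Suc (Suc ?r) = length xs" using length_xs by simp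
  ultimately show ?thesis
    by (simp add: runs_mono A_def numeral_2_eq_2)
qed

lemma runs_compute_power:
  "runs H compute_power (store xs (0 # A # 1 # vs), is, os) (18 * k + 1)
     (store xs (int (6 * k) # A # S # vs), is, os)"
proof -
  let ?s = "\<lambda>i. (store xs (int i # A # A ^ i # vs), is, os)"
  have k: "Suc 0 < length xs" using length_xs by simp
  have "runs H compute_power (?s 0) (6 * k * ((1 + 1) + 1) + 1) (?s (6 * k))"
    unfolding compute_power_def
  proof (rule runs_While)
    fix i assume i: "i < 6 * k"
    show "0 < expr_value (fst (?s i)) (Sub (Mul (Const 6) dim_k) (var 0))"
      using i k head by simp
    have "A ^ Suc i \<le> S" unfolding S_def using A_ge i by (intro power_increasing) auto
    then have bound: "\<bar>A ^ Suc i\<bar> \<le> H" using A_ge basic_bounds by simp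
    show "runs H (assign 2 (Mul (var 2) (var 1)) ;; assign 0 (Add (var 0) (Const 1)))
        (?s i) (1 + 1) (?s (Suc i))"
      apply (rule runs_assign_Seq)
         apply simp
        apply simp
      subgoal using bound by (simp add: mult.commute)
      apply (rule runs_assign)
         apply simp
        apply simp
      subgoal using counter_le(2)[of "Suc i"] i by simp
      apply (simp add: algebra_simps)
      done
  qed (use k head in simp)
  then show ?thesis by (simp add: S_def)
qed

definition partial_norm :: "nat \<Rightarrow> int" where
  "partial_norm r = (\<Sum>i<r. (M ^ i)\<^sup>2)"

definition column_sum :: "nat \<Rightarrow> int" where
  "column_sum j = (\<Sum>i<d. M ^ i * xs ! (2 + i * k + j))"

definition offset_sum :: int where
  "offset_sum = (\<Sum>i<d. M ^ i * xs ! (2 + d * k + i))"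

lemma column_index: "i < d \<Longrightarrow> j < k \<Longrightarrow> 2 + i * k + j < length xs"
proof -
  assume "i < d" "j < k"
  then have "i * k + j < Suc i * k" by simp
  moreover have "Suc i * k \<le> d * k" using \<open>i < d\<close> by (intro mult_le_mono1) simp
  ultimately show ?thesis unfolding length_xs by linarith
qed

lemma column_sum_bound: "j < k \<Longrightarrow> \<bar>S * column_sum j\<bar> \<le> X"
  unfolding column_sum_def by (rule weighted_sum_bound; (rule nth_mem[OF column_index])?; simp)

text \<open>At most \<open>d + k\<close> summands, each at most \<open>X\<^sup>2\<close>, and
  \<open>d + k \<le> 2 * A \<le> X\<close>; this is one source of the cube in \<open>H\<close>. Both
  emitting loops are covered by varying \<open>r\<close> and \<open>r'\<close>.\<close>

lemma norm_bound:
  assumes "r \<le> d" "r' \<le> k"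
  shows "\<bar>partial_norm r + (\<Sum>j<r'. (S * column_sum j)\<^sup>2)\<bar> \<le> H"
proof -
  have X: "9 \<le> X" and AX: "2 * A \<le> X"
  proof -
    have "A * 3 \<le> A ^ 2" unfolding power2_eq_square using A_ge by (intro mult_left_mono) auto
    then show "9 \<le> X" "2 * A \<le> X" using A_ge S_ge[of 2] basic_bounds by linarith+
  qed
  have "\<bar>partial_norm r\<bar> \<le> int r * X\<^sup>2" unfolding partial_norm_def
  proof (rule abs_sum_le_card)
    fix i assume "i < r"
    then have "\<bar>M ^ i\<bar> \<le> \<bar>X\<bar>" using M_le_X[of i] S_le_M[of 0] assms X by simp
    then show "\<bar>(M ^ i)\<^sup>2\<bar> \<le> X\<^sup>2" by (simp add: abs_le_square_iff)
  qed
  moreover have "\<bar>\<Sum>j<r'. (S * column_sum j)\<^sup>2\<bar> \<le> int r' * X\<^sup>2"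
  proof (rule abs_sum_le_card)
    fix j assume "j < r'"
    then have "\<bar>S * column_sum j\<bar> \<le> \<bar>X\<bar>" using column_sum_bound[of j] assms by simp
    then show "\<bar>(S * column_sum j)\<^sup>2\<bar> \<le> X\<^sup>2" by (simp add: abs_le_square_iff)
  qed
  ultimately have "\<bar>partial_norm r + (\<Sum>j<r'. (S * column_sum j)\<^sup>2)\<bar> \<le> (int r + int r') * X\<^sup>2"
    by (simp add: distrib_right)
  also have "\<dots> \<le> X * X\<^sup>2"
    using assms dims_less AX by (intro mult_right_mono) auto
  also have "\<dots> = H" by (simp add: H_def power_numeral_reduce)
  finally show ?thesis .
qed

lemma runs_emit_powers:
  "runs H emit_powers (store xs [0, A, S, M, r, 1, 0, j, c, z], is, os) (5 * d + 1)
     (store xs [int d, A, S, M, r, M ^ d, partial_norm d, j, c, z], is, os @ map (\<lambda>i. M ^ i) [0..<d])"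
proof -
  let ?s = "\<lambda>i. (store xs [int i, A, S, M, r, M ^ i, partial_norm i, j, c, z], is,
      os @ map (\<lambda>l. M ^ l) [0..<i])"
  have d: "0 < length xs" using length_xs by simp
  have "runs H emit_powers (?s 0) (d * ((1 + (1 + (1 + 1))) + 1) + 1) (?s d)"
    unfolding emit_powers_def
  proof (rule runs_While)
    fix i assume i: "i < d"
    show "0 < expr_value (fst (?s i)) (Sub dim_d (var 0))" using i d head by simp
    show "runs H (Emit (var 5) ;;
        assign 6 (Add (var 6) (Mul (var 5) (var 5))) ;;
        assign 5 (Mul (var 5) (var 3)) ;;
        assign 0 (Add (var 0) (Const 1))) (?s i) (1 + (1 + (1 + 1))) (?s (Suc i))"
      apply (rule runs_Emit_Seq)
       apply simp
      apply (rule runs_assign_Seq)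
         apply simp
        apply simp
      subgoal using norm_bound[of "Suc i" 0] i by (simp add: partial_norm_def power2_eq_square)
      apply (rule runs_assign_Seq)
         apply simp
        apply simp
      subgoal using power_M_bound[of "Suc i"] i by (simp add: mult.commute)
      apply (rule runs_end[OF runs_assign])
          apply simp
         apply simp
      subgoal using counter_le(1)[of "Suc i"] i length_xs by simp
       apply (rule refl)
      apply (simp add: algebra_simps partial_norm_def power2_eq_square)
      done
  qed (use d head in simp)
  then show ?thesis by (auto simp: partial_norm_def intro: runs_mono)
qed

lemma runs_emit_columns:
  "runs H emit_columns (store xs [int d, A, S, M, r, M ^ d, partial_norm d, 0, 0, z], is, os)
     (k * (4 * d + 8) + 1)
     (store xs [int d, A, S, M, r, M ^ d, partial_norm d + (\<Sum>j<k. (S * column_sum j)\<^sup>2), int k,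
        column_sum (k - 1), z], is, os @ map (\<lambda>j. - (S * column_sum j)) [0..<k])"
proof -
  \<comment> \<open>Cell 8 still holds the sum of the preceding column, and 0 before the first one;
    cells 0 and 5 are back at \<open>d\<close> and \<open>M ^ d\<close> after every
    \<open>weighted_sum\<close>.\<close>
  let ?s = "\<lambda>j. (store xs [int d, A, S, M, r, M ^ d,
        partial_norm d + (\<Sum>l<j. (S * column_sum l)\<^sup>2), int j,
        case j of 0 \<Rightarrow> 0 | Suc l \<Rightarrow> column_sum l, z], is, os @ map (\<lambda>l. - (S * column_sum l)) [0..<j])"
  have k: "Suc 0 < length xs" using length_xs by simp
  have "runs H emit_columns (?s 0) (k * ((4 * d + 4 + (1 + (1 + 1))) + 1) + 1) (?s k)"
    unfolding emit_columns_def
  proof (rule runs_While)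
    fix j assume j: "j < k"
    show "0 < expr_value (fst (?s j)) (Sub dim_k (var 7))" using j k head by simp
    show "runs H (weighted_sum (Add (Add (Const 2) (Mul (var 0) dim_k)) (var 7)) ;;
       Emit (Sub (Const 0) (Mul (var 2) (var 8))) ;;
       assign 6 (Add (var 6) (Mul (Mul (var 2) (var 8)) (Mul (var 2) (var 8)))) ;;
       assign 7 (Add (var 7) (Const 1))) (?s j) (4 * d + 4 + (1 + (1 + 1))) (?s (Suc j))"
      apply (rule runs_Seq)
       apply (rule runs_weighted_sum[where b = "\<lambda>i. xs ! (2 + i * k + j)"])
      subgoal for i using j k column_index[of i j] head
        by (simp add: nat_add_distrib nat_mult_distrib)
      subgoal for i using j column_index[of i j] by (intro nth_mem)
      unfolding column_sum_def[symmetric]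
      apply (rule runs_Emit_Seq)
       apply simp
      apply (rule runs_assign_Seq)
         apply simp
        apply simp
      subgoal using norm_bound[of d "Suc j"] j by (simp add: power2_eq_square add.assoc)
      apply (rule runs_end[OF runs_assign])
          apply simp
         apply simp
      subgoal using counter_le(2)[of "Suc j"] j by simp
       apply (rule refl)
      apply (simp add: algebra_simps power2_eq_square)
      done
  qed (use k head in simp)
  moreover have "k * ((4 * d + 4 + (1 + (1 + 1))) + 1) + 1 \<le> k * (4 * d + 8) + 1"
    by (intro add_right_mono mult_le_mono2) simp
  ultimately show ?thesis
    using dims(1) by (cases k) (auto intro: runs_mono)
qed

text \<open>Together with the next three definitions: \<open>\<rho>\<close>, \<open>\<tau>\<close>,
  \<open>K\<close> and \<open>\<parallel>c\<parallel>\<^sup>2\<close> of the reduction, expressed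
  through the raw input list.\<close>

definition rho :: int where "rho = S\<^sup>2 * (last xs + 1) - 1"

definition offset :: int where "offset = - (S * offset_sum)"

definition multiplier :: int where "multiplier = 1 + rho + offset\<^sup>2"

definition full_norm :: int where
  "full_norm = partial_norm d + (\<Sum>j<k. (S * column_sum j)\<^sup>2)"

definition result :: "int list" where
  "result = int (d + k) # map (\<lambda>i. M ^ i) [0..<d] @ map (\<lambda>j. - (S * column_sum j)) [0..<k] @
     [multiplier\<^sup>2 * full_norm + 2 * multiplier * offset + rho, multiplier * full_norm + offset]"

lemma rho_bound: "0 \<le> rho" "rho + 1 \<le> M"
proof -
  have len: "xs \<noteq> []" using length_xs by auto
  then have last: "last xs + 1 \<le> S" using entry_less[of "last xs"] basic_bounds by auto
  have "S\<^sup>2 * (last xs + 1) \<le> S\<^sup>2 * S" using last by (intro mult_left_mono) auto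
  then show "rho + 1 \<le> M" using S_le_M[of 3] by (simp add: rho_def power_numeral_reduce)
  have "1 * 1 \<le> S\<^sup>2 * (last xs + 1)" using beta S_ge[of 0] by (intro mult_mono) (auto simp: one_le_power)
  then show "0 \<le> rho" by (simp add: rho_def)
qed

lemma offset_index: "i < d \<Longrightarrow> 2 + d * k + i < length xs"
  by (simp add: length_xs)

lemma offset_bound: "\<bar>S * offset_sum\<bar> \<le> X"
  unfolding offset_sum_def by (rule weighted_sum_bound; (rule nth_mem[OF offset_index])?; simp)

text \<open>\<open>1 + \<rho> \<le> X \<le> X\<^sup>2\<close> and
  \<open>\<tau>\<^sup>2 \<le> X\<^sup>2\<close> add up to at most
  \<open>2 * X\<^sup>2 \<le> X ^ 3\<close>.\<close>

lemma multiplier_bound: "\<bar>multiplier\<bar> \<le> H"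
proof -
  have "\<bar>offset\<bar> \<le> \<bar>X\<bar>" using offset_bound by (simp add: offset_def)
  then have "offset\<^sup>2 \<le> X\<^sup>2" by (simp only: abs_le_square_iff)
  moreover have "X * 1 \<le> X\<^sup>2" "X\<^sup>2 * 2 \<le> X\<^sup>2 * X"
    using A_ge basic_bounds unfolding power2_eq_square by (intro mult_left_mono; simp)+
  ultimately have "multiplier \<le> X\<^sup>2 * X"
    using rho_bound basic_bounds unfolding multiplier_def by linarith
  moreover have "0 \<le> multiplier" using rho_bound by (simp add: multiplier_def)
  ultimately show ?thesis by (simp add: H_def power_numeral_reduce)
qed

lemma runs_reduction_program:
  "\<exists>m. runs H reduction_program (\<lambda>_. 0, xs, []) (60 * length xs) (m, [], result)"
proof -
  obtain ys where xs: "xs = int d # int k # ys"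
    using length_xs head by (cases xs; cases "tl xs") auto
  have start: "(\<lambda>_. 0) = store [] (replicate 10 0)"
    by (auto simp: store_def fun_eq_iff)
  \<comment> \<open>After the two dimensions the accumulator is already a prefix sum, which is the
    state in which \<open>read_input\<close> starts.\<close>
  have A_start: "1 + (int d * int d + int k * int k) = 1 + (\<Sum>x\<leftarrow>take 2 xs. x\<^sup>2)"
    unfolding xs by (simp add: power2_eq_square)
  have "0 \<le> (\<Sum>x\<leftarrow>drop 2 xs. x\<^sup>2)" by (intro sum_list_nonneg) auto
  then have "1 + (int d * int d + int k * int k) \<le> A"
    unfolding A_def xs by (simp add: power2_eq_square)
  then have A_start_le: "\<bar>1 + (int d * int d + int k * int k)\<bar> \<le> H"
    using basic_bounds by simp
  have two: "2 \<le> H" using A_ge basic_bounds by simp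
  have M: "S * S * (S * S) * (S * S) = M" by (simp add: M_def power_numeral_reduce)
  have "last xs = xs ! (d * k + d + 2)"
    using length_xs by (subst last_conv_nth) auto
  then have R: "S * S * (xs ! Suc (Suc (d * k + d)) + 1) - 1 = rho"
    by (simp add: rho_def power2_eq_square)
  note head = head head(2)[simplified]
  have idx: "xs \<noteq> []" "Suc 0 < length xs" "Suc (Suc (d * k + d)) < length xs"
    using length_xs by auto
  have nat_idx: "nat (int d * int k + int d + 2) = Suc (Suc (d * k + d))"
    by (simp add: nat_add_distrib nat_mult_distrib)
  have "runs H reduction_program (store [] (replicate 10 0), int d # int k # ys, []) (60 * length xs)
    (store xs [int d, A, S, M, rho, M ^ d, full_norm, offset, offset_sum, multiplier], [], result)"
    unfolding reduction_program_def
    apply (rule runs_mono)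
     apply (rule runs_Read_Seq, simp)
     apply (rule runs_Read_Seq, simp)
     apply (rule runs_assign_Seq, simp, simp, rule A_start_le)
     apply (rule runs_assign_Seq, simp, simp, simp add: two)
     apply (rule runs_Seq)
      apply (rule runs_start[OF runs_read_input[of "replicate 8 0"]])
      apply (simp add: xs eval_nat_numeral power2_eq_square)
     apply (rule runs_assign_Seq, simp, simp, simp add: H_ge)
     apply (rule runs_assign_Seq, simp, simp, simp add: H_ge)
     apply (rule runs_Seq)
      apply (rule runs_start[OF runs_compute_power[of "replicate 7 0" "[]" "[]"]])
      apply (simp add: eval_nat_numeral)
     apply (rule runs_assign_Seq, simp, simp add: M)
    subgoal using basic_bounds A_ge by simp
     apply (rule runs_assign_Seq, simp add: eval_nat_numeral)
       apply (simp add: eval_nat_numeral idx head nat_idx R)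
    subgoal using rho_bound basic_bounds by simp
     apply (rule runs_Emit_Seq)
      apply (simp add: idx head)
     apply (rule runs_assign_Seq, simp, simp, simp add: H_ge)
     apply (rule runs_assign_Seq, simp, simp, simp add: H_ge)
     apply (rule runs_assign_Seq, simp, simp, simp add: H_ge)
     apply (rule runs_Seq)
      apply (rule runs_start[OF runs_emit_powers[of rho 0 0 0 "[]" "[int d + int k]"]])
      apply (simp add: eval_nat_numeral head)
     apply (rule runs_assign_Seq, simp, simp, simp add: H_ge)
     apply (rule runs_Seq)
      apply (rule runs_start[OF runs_emit_columns[of rho 0 "[]" "[int d + int k] @ map (\<lambda>i. M ^ i) [0..<d]"]])
      apply (simp add: eval_nat_numeral)
     apply (rule runs_Seq)
      apply (rule runs_weighted_sum[where b = "\<lambda>i. xs ! (2 + d * k + i)"])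
    subgoal for i using idx head offset_index[of i]
      by (simp add: nat_add_distrib nat_mult_distrib)
    subgoal for i using offset_index[of i] by (intro nth_mem)
    unfolding offset_sum_def[symmetric]
     apply (rule runs_assign_Seq, simp, simp)
    subgoal using offset_bound basic_bounds by simp
     apply (rule runs_assign_Seq, simp, simp)
    subgoal using multiplier_bound by (simp add: multiplier_def offset_def power2_eq_square)
     apply (rule runs_Emit_Seq)
      apply simp
     apply (rule runs_end[OF runs_Emit])
      apply simp
     apply (simp add: result_def multiplier_def offset_def full_norm_def power2_eq_square)
    \<comment> \<open>The step counts add up to at most a multiple of
      \<open>d * k + d + k + 1\<close>; with \<open>k \<le> d\<close> and
      \<open>length xs = d * k + d + 3\<close> the factor 60 is large enough.\<close>
    using dims length_xs apply (simp add: algebra_simps)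
    done
  then show ?thesis unfolding start xs[symmetric] by blast
qed

end

section \<open>Polynomial running time\<close>

text \<open>Row-major addressing, which justifies the addresses \<open>2 + i * k + j\<close> of the
  program.\<close>

lemma concat_nth_uniform:
  assumes "\<And>ys. ys \<in> set yss \<Longrightarrow> length ys = k" "i < length yss" "j < k"
  shows "concat yss ! (i * k + j) = yss ! i ! j"
  using assms
proof (induction yss arbitrary: i)
  case (Cons ys yss)
  then show ?case by (cases i) (auto simp: nth_append add.assoc)
qed simp

lemma length_concat_mat_to_list: "length (concat (mat_to_list B)) = dim_row B * dim_col B"
  by (simp add: mat_to_list_def length_concat comp_def sum_list_triv)

lemma encode_cvp_nth:
  assumes B: "B \<in> carrier_mat d k" and t: "t \<in> carrier_vec d"
  shows "encode_cvp (B, t, \<beta>) ! 0 = int d" "encode_cvp (B, t, \<beta>) ! 1 = int k"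
    "i < d \<Longrightarrow> j < k \<Longrightarrow> encode_cvp (B, t, \<beta>) ! (2 + i * k + j) = B $$ (i, j)"
    "i < d \<Longrightarrow> encode_cvp (B, t, \<beta>) ! (2 + d * k + i) = t $ i"
    "length (encode_cvp (B, t, \<beta>)) = d * k + d + 3"
proof -
  have dims: "dim_row B = d" "dim_col B = k" "dim_vec t = d" using B t by auto
  note len = length_concat_mat_to_list[of B, unfolded dims]
  show "encode_cvp (B, t, \<beta>) ! 0 = int d" "encode_cvp (B, t, \<beta>) ! 1 = int k"
    "length (encode_cvp (B, t, \<beta>)) = d * k + d + 3"
    using len dims by simp_all
  show "encode_cvp (B, t, \<beta>) ! (2 + i * k + j) = B $$ (i, j)" if ij: "i < d" "j < k"
  proof -
    have "i * k + j < Suc i * k" using ij by simp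
    moreover have "Suc i * k \<le> d * k" using ij by (intro mult_le_mono1) simp
    ultimately have "i * k + j < d * k" by linarith
    then have "encode_cvp (B, t, \<beta>) ! (2 + i * k + j) = concat (mat_to_list B) ! (i * k + j)"
      using len by (simp add: nth_append)
    also have "\<dots> = mat_to_list B ! i ! j"
      using ij dims by (intro concat_nth_uniform) (auto simp: mat_to_list_def)
    finally show ?thesis using ij dims by (simp add: mat_to_list_def)
  qed
  show "encode_cvp (B, t, \<beta>) ! (2 + d * k + i) = t $ i" if "i < d"
    using that len dims by (simp add: nth_append)
qed

lemma reduction_program_correct:
  assumes B: "B \<in> carrier_mat d k" and t: "t \<in> carrier_vec d" and k: "1 \<le> k" "k \<le> d"
    and beta: "0 \<le> \<beta>"
  defines "xs \<equiv> encode_cvp (B, t, \<beta>)"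
  defines "H \<equiv> magnitude (B, t, \<beta>) ^ (108 * k * (d + 1))"
  shows "\<exists>m. runs H reduction_program (\<lambda>_. 0, xs, []) (60 * length xs)
      (m, [], encode_ballip (reduction (B, t, \<beta>)))"
proof -
  define A where A_mag: "A = magnitude (B, t, \<beta>)"
  define S where "S = A ^ (6 * k)"
  define M where "M = S ^ 6"
  have shape: "dim_row B = d" "dim_col B = k" "dim_vec t = d" using B t by auto
  note nth = encode_cvp_nth[OF B t, where \<beta> = \<beta>, folded xs_def]
  interpret reduction_run d k xs A S M "M ^ (d + 1)" H
  proof unfold_locales
    \<comment> \<open>The exponent collects \<open>6 * k\<close> from \<open>S\<close>, 6 from
      \<open>M\<close>, \<open>d + 1\<close> from \<open>X\<close> and 3 from
      \<open>H\<close>.\<close>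
    show "H = (M ^ (d + 1)) ^ 3"
      unfolding H_def A_mag[symmetric] M_def S_def power_mult[symmetric]
      by (rule arg_cong[where f = "\<lambda>n. A ^ n"]) simp
    show "A = 1 + (\<Sum>x\<leftarrow>xs. x\<^sup>2)" by (simp only: A_mag magnitude_def xs_def)
  qed (use k nth beta in \<open>simp_all add: S_def M_def\<close>, simp add: xs_def)
  have rho: "rho = S\<^sup>2 * (\<beta> + 1) - 1" unfolding rho_def by (simp add: xs_def)
  have column: "column_sum j = (\<Sum>i<d. M ^ i * B $$ (i, j))" if "j < k" for j
    unfolding column_sum_def by (intro sum.cong) (use nth that in auto)
  have offset: "offset = ball_offset S M t"
    unfolding offset_def offset_sum_def ball_offset_def shape
    by (intro arg_cong[where f = "\<lambda>x. - (S * x)"] sum.cong) (use nth shape in auto)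
  have normal: "ball_normal S M B = vec d (\<lambda>i. M ^ i) @\<^sub>v vec k (\<lambda>j. - (S * column_sum j))"
    unfolding ball_normal_def shape
    by (intro arg_cong2[where f = append_vec] refl eq_vecI) (auto simp: column)
  have norm: "sq_norm2 (ball_normal S M B) = full_norm"
    unfolding normal sq_norm2_append full_norm_def partial_norm_def by (simp add: sq_norm2_eq_sum)
  have "encode_ballip (reduction (B, t, \<beta>)) = result"
    unfolding reduction.simps Let_def shape A_mag[symmetric] S_def[symmetric] M_def[symmetric]
      rho[symmetric] offset[symmetric] multiplier_def[symmetric] norm
    by (simp add: normal result_def)
  then show ?thesis using runs_reduction_program by simp
qed

lemma bit_length_magnitude_power:
  "bit_length (magnitude x ^ n) \<le> 2 * encoding_length (encode_cvp x) * n + 2"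
proof -
  let ?E = "encoding_length (encode_cvp x)"
  note ge = magnitude_ge_1[of x]
  have "magnitude x ^ n \<le> (4 ^ ?E) ^ n"
    using ge sum_squares_le_encoding_length[of "encode_cvp x"]
    by (intro power_mono) (auto simp: magnitude_def)
  also have "(4 ^ ?E) ^ n = (2 :: int) ^ (2 * ?E * n)"
    by (simp add: power_mult)
  also have "\<dots> < 2 ^ (2 * ?E * n + 1)" by simp
  finally have "bit_length (magnitude x ^ n) \<le> Suc (2 * ?E * n + 1)"
    unfolding bit_length_le_Suc_iff using ge by simp
  then show ?thesis by simp
qed

lemma reduction_poly_time:
  "\<exists>p :: nat poly. \<forall>x\<in>cvp_instances. \<exists>n m xs.
     exec reduction_program (\<lambda>_. 0, encode_cvp x, []) n (m, xs, encode_ballip (reduction x)) \<and>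
     n \<le> poly p (encoding_length (encode_cvp x))"
proof -
  let ?w = "program_weight reduction_program"
  \<comment> \<open>With \<open>E\<close> the encoding length: at most \<open>60 * E\<close> steps,
    each of cost at most \<open>?w\<close> times the squared length of \<open>H\<close>, and that
    length is at most \<open>216 * E ^ 3 + 2\<close>.\<close>
  let ?p = "[:0, 60 * ?w:] * [:2, 0, 0, 216:]\<^sup>2 :: nat poly"
  have "\<exists>n m xs. exec reduction_program (\<lambda>_. 0, encode_cvp x, []) n (m, xs, encode_ballip (reduction x)) \<and>
     n \<le> poly ?p (encoding_length (encode_cvp x))" if x: "x \<in> cvp_instances" for x
  proof -
    obtain B t \<beta> where x_eq: "x = (B, t, \<beta>)" by (cases x)
    define d k where "d = dim_row B" and "k = dim_col B"
    have B: "B \<in> carrier_mat d k" and t: "t \<in> carrier_vec d" and k: "1 \<le> k" "k \<le> d" "0 \<le> \<beta>"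
      using x by (auto simp: x_eq cvp_instances_def d_def k_def intro: carrier_vecI)
    define E where "E = encoding_length (encode_cvp x)"
    define H where "H = magnitude x ^ (108 * k * (d + 1))"
    obtain m where runs: "runs H reduction_program (\<lambda>_. 0, encode_cvp x, [])
        (60 * length (encode_cvp x)) (m, [], encode_ballip (reduction x))"
      using reduction_program_correct[OF B t k] unfolding H_def x_eq by blast
    have len: "length (encode_cvp x) \<le> E" unfolding E_def by (rule length_le_encoding_length)
    have "d + 1 \<le> length (encode_cvp x)"
      unfolding x_eq encode_cvp_nth(5)[OF B t] by simp
    \<comment> \<open>Each entry has length at least 1, so the dimensions themselves, not only their
      logarithms, are bounded by the input length. This keeps the exponent of \<open>H\<close>
      polynomial.\<close>
    then have dk: "d + 1 \<le> E" "k \<le> E" using len k by auto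
    note ge = magnitude_ge_1[of x]
    have "bounded_config H (\<lambda>_. 0, encode_cvp x, [])"
    proof -
      have "\<bar>a\<bar> \<le> H" if "a \<in> set (encode_cvp x)" for a
      proof -
        have "a\<^sup>2 \<le> (\<Sum>a\<leftarrow>encode_cvp x. a\<^sup>2)"
          by (rule member_le_sum_list) (use that in auto)
        then have "\<bar>a\<bar> \<le> magnitude x" using abs_le_square_int[of a] unfolding magnitude_def by linarith
        also have "\<dots> \<le> H" unfolding H_def using ge k by (intro self_le_power) auto
        finally show ?thesis .
      qed
      moreover have "0 \<le> H" using ge by (simp add: H_def)
      ultimately show ?thesis by (auto simp: bounded_config_def)
    qed
    with runs obtain n where n: "exec reduction_program (\<lambda>_. 0, encode_cvp x, []) n
        (m, [], encode_ballip (reduction x))"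
      "n \<le> 60 * length (encode_cvp x) * ?w * (bit_length H)\<^sup>2"
      unfolding runs_def by blast
    have "bit_length H \<le> 2 * E * (108 * k * (d + 1)) + 2"
      unfolding H_def E_def by (rule bit_length_magnitude_power)
    also have "\<dots> \<le> 2 * E * (108 * E * E) + 2"
      using dk by (intro add_right_mono mult_le_mono order_refl)
    finally have "bit_length H \<le> 2 + 216 * E ^ 3" by (simp add: power3_eq_cube algebra_simps)
    then have "60 * length (encode_cvp x) * ?w * (bit_length H)\<^sup>2 \<le> 60 * E * ?w * (2 + 216 * E ^ 3)\<^sup>2"
      using len by (intro mult_le_mono power_mono order_refl) auto
    also have "\<dots> = poly ?p E"
      by (simp add: power3_eq_cube algebra_simps)
    finally show ?thesis using n unfolding E_def by (meson order_trans)
  qed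
  then show ?thesis by blast
qed

theorem theorem5p8:
  shows "\<exists>f :: cvp_instance \<Rightarrow> ballip_instance.
    poly_time_computable_on cvp_instances encode_cvp encode_ballip f \<and>
    (\<exists>q :: nat poly. \<forall>x \<in> cvp_instances.
       encoding_length (encode_ballip (f x)) \<le> poly q (encoding_length (encode_cvp x))) \<and>
    (\<forall>d k B t \<beta>. 1 \<le> k \<longrightarrow> k \<le> d \<longrightarrow> B \<in> carrier_mat d k \<longrightarrow> t \<in> carrier_vec d \<longrightarrow> 0 \<le> \<beta> \<longrightarrow>
       vec_space.rank d (map_mat real_of_int B) = k \<longrightarrow>
       (\<exists>c r2 \<Gamma>. f (B, t, \<beta>) = (c, r2, \<Gamma>) \<and> c \<in> carrier_vec (d + k) \<and> 0 \<le> r2 \<and>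
          ((\<exists>z \<in> carrier_vec k. sq_norm2 (B *\<^sub>v z - t) \<le> \<beta>) \<longleftrightarrow>
           (\<exists>W \<in> carrier_vec (d + k). sq_norm2 W \<le> r2 \<and> c \<bullet> W \<ge> \<Gamma>)))) \<and>
    (\<forall>n B t \<beta>. 1 \<le> n \<longrightarrow> B \<in> carrier_mat n n \<longrightarrow> (B, t, \<beta>) \<in> cvp_instances \<longrightarrow>
       f (B, t, \<beta>) \<in> ballip_instances (2 * n))"
proof (intro exI[of _ reduction] conjI allI impI)
  obtain p :: "nat poly" where p: "\<And>x. x \<in> cvp_instances \<Longrightarrow> \<exists>n m xs.
     exec reduction_program (\<lambda>_. 0, encode_cvp x, []) n (m, xs, encode_ballip (reduction x)) \<and>
     n \<le> poly p (encoding_length (encode_cvp x))"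
    using reduction_poly_time by blast
  then show "poly_time_computable_on cvp_instances encode_cvp encode_ballip reduction"
    unfolding poly_time_computable_on_def by blast
  have "encoding_length (encode_ballip (reduction x)) \<le> poly p (encoding_length (encode_cvp x))"
    if x: "x \<in> cvp_instances" for x
  proof -
    obtain n m xs where n: "exec reduction_program (\<lambda>_. 0, encode_cvp x, []) n
        (m, xs, encode_ballip (reduction x))" "n \<le> poly p (encoding_length (encode_cvp x))"
      using p[OF x] by blast
    \<comment> \<open>The output was paid for during the run, so the polynomial for the time serves
      for the length as well.\<close>
    have "encoding_length (encode_ballip (reduction x)) \<le> n"
      using exec_output_length[OF n(1)] unfolding snd_conv by (simp add: encoding_length_def)
    with n(2) show ?thesis by linarith
  qed
  then show "\<exists>q :: nat poly. \<forall>x \<in> cvp_instances.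
       encoding_length (encode_ballip (reduction x)) \<le> poly q (encoding_length (encode_cvp x))"
    by blast
next
  fix d k :: nat and B :: "int mat" and t :: "int vec" and \<beta> :: int
  assume "1 \<le> k" "k \<le> d" "B \<in> carrier_mat d k" "t \<in> carrier_vec d" "0 \<le> \<beta>"
    "vec_space.rank d (map_mat real_of_int B) = k"
  moreover obtain c r2 \<Gamma> where "reduction (B, t, \<beta>) = (c, r2, \<Gamma>)" by (cases "reduction (B, t, \<beta>)")
  ultimately show "\<exists>c r2 \<Gamma>. reduction (B, t, \<beta>) = (c, r2, \<Gamma>) \<and> c \<in> carrier_vec (d + k) \<and> 0 \<le> r2 \<and>
          ((\<exists>z \<in> carrier_vec k. sq_norm2 (B *\<^sub>v z - t) \<le> \<beta>) \<longleftrightarrow>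
           (\<exists>W \<in> carrier_vec (d + k). sq_norm2 W \<le> r2 \<and> c \<bullet> W \<ge> \<Gamma>))"
    using reduction_correct[of B d k t \<beta> c r2 \<Gamma>] by blast
next
  fix n :: nat and B :: "int mat" and t :: "int vec" and \<beta> :: int
  assume n: "1 \<le> n" "B \<in> carrier_mat n n" "(B, t, \<beta>) \<in> cvp_instances"
  obtain c r2 \<Gamma> where red: "reduction (B, t, \<beta>) = (c, r2, \<Gamma>)" by (cases "reduction (B, t, \<beta>)")
  have "t \<in> carrier_vec n" "0 \<le> \<beta>" "vec_space.rank n (map_mat real_of_int B) = n"
    using n by (auto simp: cvp_instances_def intro: carrier_vecI)
  then show "reduction (B, t, \<beta>) \<in> ballip_instances (2 * n)"
    using reduction_correct(1,2)[OF n(2) _ n(1) order_refl _ _ red]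
    unfolding red ballip_instances_def mult_2 by blast
qed

end
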